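(* Let $\nu>-1$. Then for every integer $n\ge1$, $$\sum_{k \ge 1} \frac{\big(j_k^{\nu+1}\big)^2}{\Big[\big(j_n^{\nu}\big)^2-\big(j_k^{\nu+1}\big)^2\Big]^2} = \frac{1}{4}.$$
   Context: For $\mu>-1$, $\{j_n^{\mu}: n\ge1\}$ denotes the sequence of strictly positive zeros, in ascending order, of the Bessel function of the first kind $J_\mu$. *)

theory Defs
  imports "HOL-Analysis.Analysis"
begin

text \<open>
  Bessel function of the first kind of real order, by its power series. Only meant for
  \<open>x > 0\<close>: the value of \<open>powr\<close> at a nonpositive base is not the analytic continuation
  (nor the limit at \<open>0\<close>).
\<close>

definition bessel_J :: "real \<Rightarrow> real \<Rightarrow> real" where
  "bessel_J \<mu> x =
     (\<Sum>m. (-1) ^ m / (fact m * Gamma (real m + \<mu> + 1)) * (x / 2) powr (2 * real m + \<mu>))"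

text \<open>
  The strictly positive zeros in ascending order, numbered from \<open>1\<close>; the value \<open>0\<close> at index
  \<open>0\<close> is not a zero but only the lower bound for the first one.
\<close>

primrec bessel_zero :: "real \<Rightarrow> nat \<Rightarrow> real" where
  "bessel_zero \<mu> 0 = 0"
| "bessel_zero \<mu> (Suc n) = (LEAST x. bessel_zero \<mu> n < x \<and> bessel_J \<mu> x = 0)"

end

theory Submission
  imports Defs "HOL-Complex_Analysis.Great_Picard" "HOL-Real_Asymp.Real_Asymp"
begin

text \<open>
  Substituting \<open>t = x\<^sup>2 / 4\<close> turns \<open>J\<^sub>\<mu>(x)\<close> into a power of \<open>x\<close> times the entire
  Bessel-Clifford function \<open>C\<^sub>\<mu>(t) = \<Sum>m. (-t)^m / (m! Gamma (m + \<mu> + 1))\<close>, which satisfies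
  \<open>C\<^sub>\<mu>' = - C\<^sub>\<mu>\<^sub>+\<^sub>1\<close> and \<open>C\<^sub>\<mu> = (\<mu> + 1) C\<^sub>\<mu>\<^sub>+\<^sub>1 - t C\<^sub>\<mu>\<^sub>+\<^sub>2\<close>. Put \<open>r = C\<^sub>\<mu>\<^sub>+\<^sub>1 / C\<^sub>\<mu>\<close> with
  \<open>\<mu> = \<nu> + 1\<close>, and let \<open>1 / x\<^sub>k\<close> be the zeros of \<open>C\<^sub>\<mu>\<close>. If \<open>C\<^sub>\<mu>\<close> is the product of the
  factors \<open>1 - t x\<^sub>k\<close> up to a constant, then \<open>r(t) = \<Sum>k. x\<^sub>k / (1 - t x\<^sub>k)\<close>, and the
  derivative of \<open>t r(t)\<close>, computed from the product and from the differential equation, gives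
  \<open>\<Sum>k. x\<^sub>k / (1 - t x\<^sub>k)\<^sup>2 = 1 - \<mu> r + t r\<^sup>2\<close> (lemma \<open>sums_weighted\<close>). At a zero \<open>t\<close> of
  \<open>C\<^sub>\<nu>\<close> the recurrence says \<open>t r = \<mu>\<close>, so the right-hand side is \<open>1\<close>. With
  \<open>t = (j\<^sub>n\<^sup>\<nu>)\<^sup>2 / 4\<close> and \<open>1 / x\<^sub>k = (j\<^sub>k\<^sup>\<nu>\<^sup>+\<^sup>1)\<^sup>2 / 4\<close> this is four times the claimed sum.

  What has to be shown is the factorization, or rather its two logarithmic derivatives. Instead
  of Hadamard's theorem the proof uses that \<open>C\<^sub>\<mu>\<close> is the limit of the rescaled Laguerre
  polynomials of degree \<open>n + 1\<close>, whose zeros are positive and distinct by a Rolle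
  argument (\<open>laguerre_roots\<close>). Their reciprocal zeros, in decreasing order, have the
  constant sum \<open>1 / (\<mu> + 1)\<close>, so the \<open>k\<close>-th of them (from \<open>0\<close>) is at most
  \<open>1 / ((\<mu> + 1) (k + 1))\<close>. This makes a subsequence converge for every \<open>k\<close>, and it
  dominates sums of squares of the reciprocal zeros, so that the identities for polynomials
  pass to the limit (\<open>sums_of_limit_points\<close>) and every zero of \<open>C\<^sub>\<mu>\<close> is captured exactly
  once (\<open>clifford_C_zero_iff\<close>, \<open>x_distinct\<close>).

  Only the sum of the \<open>x\<^sub>k\<close> themselves is not dominated: part of the mass \<open>1 / (\<mu> + 1)\<close>
  could escape to \<open>0\<close>, which would be a factor \<open>exp (- a t)\<close> in the limit. The behaviour on the
  negative axis excludes this, because there the Riccati equation of \<open>r\<close> forces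
  \<open>r(-y) \<longrightarrow> 0\<close> as \<open>y\<close> grows, whereas \<open>r \<ge> a\<close> (\<open>sums_x\<close>). The same
  equation shows that there are infinitely many zeros (\<open>infinite_x_pos\<close>), so that the recursive
  enumeration by least elements reaches all of them.
\<close>

section \<open>The Bessel-Clifford function\<close>

definition clifford_term :: "real \<Rightarrow> nat \<Rightarrow> real" where
  "clifford_term \<mu> m = 1 / (fact m * Gamma (real m + \<mu> + 1))"

text \<open>
  The weights \<open>b\<close> let one definition serve for the entire function (\<open>b = 1\<close>) and for its
  polynomial approximants, and make this family closed under differentiation.
\<close>

definition clifford :: "(nat \<Rightarrow> real) \<Rightarrow> real \<Rightarrow> real \<Rightarrow> real" where
  "clifford b \<mu> t = (\<Sum>m. b m * clifford_term \<mu> m * (- t) ^ m)"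

abbreviation clifford_C :: "real \<Rightarrow> real \<Rightarrow> real" where
  "clifford_C \<equiv> clifford (\<lambda>_. 1)"

lemma clifford_term_pos: "\<mu> > -1 \<Longrightarrow> clifford_term \<mu> m > 0"
  unfolding clifford_term_def by (intro divide_pos_pos mult_pos_pos Gamma_real_pos) auto

lemma clifford_term_Suc:
  assumes "\<mu> > -1"
  shows "clifford_term \<mu> (Suc m) = clifford_term \<mu> m / (real (Suc m) * (real m + \<mu> + 1))"
proof -
  have *: "real m + \<mu> + 1 \<notin> \<int>\<^sub>\<le>\<^sub>0"
    using assms by (auto dest!: nonpos_Ints_nonpos)
  have "Gamma (real (Suc m) + \<mu> + 1) = (real m + \<mu> + 1) * Gamma (real m + \<mu> + 1)"
    using Gamma_plus1[OF *] by (simp add: add_ac)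
  then show ?thesis
    by (simp add: clifford_term_def)
qed

lemma clifford_term_diffs: "real (Suc m) * clifford_term \<mu> (Suc m) = clifford_term (\<mu> + 1) m"
  by (simp add: clifford_term_def add_ac del: of_nat_Suc) (simp add: add_ac)

lemma clifford_term_shift:
  assumes "\<mu> > -1"
  shows "clifford_term \<mu> m = (real m + \<mu> + 1) * clifford_term (\<mu> + 1) m"
proof -
  have "clifford_term (\<mu> + 1) m = real (Suc m) * clifford_term \<mu> (Suc m)"
    by (rule clifford_term_diffs[symmetric])
  also have "\<dots> = clifford_term \<mu> m / (real m + \<mu> + 1)"
    using assms by (subst clifford_term_Suc) auto
  finally show ?thesis
    using assms by simp
qed

lemma clifford_term_0_ratio: "\<mu> > -1 \<Longrightarrow> clifford_term (\<mu> + 1) 0 / clifford_term \<mu> 0 = 1 / (\<mu> + 1)"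
  using clifford_term_shift[of \<mu> 0] clifford_term_pos[of "\<mu> + 1" 0] by simp

lemma summable_clifford_term:
  assumes "\<mu> > -1"
  shows "summable (\<lambda>m. clifford_term \<mu> m * y ^ m)"
proof -
  (* Beyond N the ratio |y| / ((m + 1) (m + \<mu> + 1)) of consecutive terms is at most 1/2. *)
  obtain N :: nat where N: "real N \<ge> 2 * \<bar>y\<bar>" "N \<ge> 1"
    by (meson le_trans nat_le_linear of_nat_mono order_trans real_arch_simple)
  show ?thesis
  proof (rule summable_ratio_test[of "1/2" N])
    fix m assume m: "m \<ge> N"
    have "2 * \<bar>y\<bar> * 1 \<le> real (Suc m) * (real m + \<mu> + 1)"
    proof (rule order_trans)
      show "2 * \<bar>y\<bar> * 1 \<le> real m * 1" using N m by (smt (verit) of_nat_mono mult.right_neutral)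
      have "real m * 1 \<le> real m * real (Suc m)"
        by (intro mult_left_mono) auto
      also have "\<dots> \<le> real (Suc m) * (real m + \<mu> + 1)"
        using assms by (subst mult.commute) (intro mult_left_mono, auto)
      finally show "real m * 1 \<le> real (Suc m) * (real m + \<mu> + 1)" .
    qed
    moreover have pos: "real (Suc m) * (real m + \<mu> + 1) > 0"
      using assms by (intro mult_pos_pos) auto
    ultimately have d: "\<bar>y\<bar> / (real (Suc m) * (real m + \<mu> + 1)) \<le> 1 / 2"
      by (subst pos_divide_le_eq) auto
    have a: "\<bar>real m + \<mu> + 1\<bar> = real m + \<mu> + 1"
      using assms by simp
    from d have "clifford_term \<mu> m * \<bar>y\<bar> ^ m * (\<bar>y\<bar> / (real (Suc m) * (real m + \<mu> + 1)))
        \<le> clifford_term \<mu> m * \<bar>y\<bar> ^ m * (1 / 2)"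
      using clifford_term_pos[OF assms, of m] by (intro mult_left_mono) auto
    then show "norm (clifford_term \<mu> (Suc m) * y ^ Suc m) \<le> 1 / 2 * norm (clifford_term \<mu> m * y ^ m)"
      using a clifford_term_pos[OF assms, of m] clifford_term_pos[OF assms, of "Suc m"]
      by (simp add: abs_mult clifford_term_Suc[OF assms] power_abs mult_ac del: of_nat_Suc)
  qed auto
qed

lemma summable_clifford:
  assumes "\<mu> > -1" "\<And>m. \<bar>b m\<bar> \<le> 1"
  shows "summable (\<lambda>m. b m * clifford_term \<mu> m * y ^ m)"
proof (rule summable_comparison_test')
  show "summable (\<lambda>m. clifford_term \<mu> m * \<bar>y\<bar> ^ m)"
    by (rule summable_clifford_term[OF assms(1)])
  fix m
  have "\<bar>b m\<bar> * (clifford_term \<mu> m * \<bar>y\<bar> ^ m) \<le> 1 * (clifford_term \<mu> m * \<bar>y\<bar> ^ m)"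
    using clifford_term_pos[OF assms(1), of m] assms(2) by (intro mult_right_mono) auto
  then show "norm (b m * clifford_term \<mu> m * y ^ m) \<le> clifford_term \<mu> m * \<bar>y\<bar> ^ m"
    using clifford_term_pos[OF assms(1), of m] by (simp add: abs_mult power_abs mult_ac)
qed

lemma clifford_at_0: "clifford b \<mu> 0 = b 0 * clifford_term \<mu> 0"
  unfolding clifford_def using powser_zero[of "\<lambda>m. b m * clifford_term \<mu> m"] by simp

lemma has_derivative_clifford:
  assumes "\<mu> > -1" "\<And>m. \<bar>b m\<bar> \<le> 1"
  shows "(clifford b \<mu> has_field_derivative - clifford (\<lambda>m. b (Suc m)) (\<mu> + 1) t) (at t)"
proof -
  let ?c = "\<lambda>m. b m * clifford_term \<mu> m"
  have "((\<lambda>y. \<Sum>m. ?c m * y ^ m) has_field_derivative (\<Sum>m. diffs ?c m * (- t) ^ m)) (at (- t))"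
    by (rule termdiffs_strong_converges_everywhere) (rule summable_clifford[OF assms])
  then have "((\<lambda>t. \<Sum>m. ?c m * (- t) ^ m) has_field_derivative (\<Sum>m. diffs ?c m * (- t) ^ m) * (-1)) (at t)"
    by (rule DERIV_chain2) (auto intro!: derivative_eq_intros)
  moreover have "diffs ?c = (\<lambda>m. b (Suc m) * clifford_term (\<mu> + 1) m)"
    unfolding diffs_def clifford_term_diffs[symmetric] by (simp add: mult_ac)
  ultimately show ?thesis
    by (simp add: clifford_def[abs_def])
qed

text \<open>
  Together with the derivative rule this is the differential equation
  \<open>t C'' + (\<mu> + 1) C' + C = 0\<close>.
\<close>

lemma clifford_C_recurrence:
  assumes "\<mu> > -1"
  shows "clifford_C \<mu> t = (\<mu> + 1) * clifford_C (\<mu> + 1) t - t * clifford_C (\<mu> + 2) t"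
proof -
  have s: "summable (\<lambda>m. clifford_term \<mu>' m * (- t) ^ m)" if "\<mu>' > -1" for \<mu>'
    by (rule summable_clifford_term[OF that])
  define f where "f = (\<lambda>m. real m * clifford_term (\<mu> + 1) m * (- t) ^ m)"
  have "f (Suc m) = - t * (clifford_term (\<mu> + 2) m * (- t) ^ m)" for m
    using clifford_term_diffs[of m "\<mu> + 1"] by (simp add: f_def add_ac del: of_nat_Suc)
  then have "(\<lambda>m. f (Suc m)) sums (- t * clifford_C (\<mu> + 2) t)"
    using sums_mult[OF summable_sums[OF s[of "\<mu> + 2"]], of "- t"] assms
    by (simp add: clifford_def)
  then have f: "f sums (- t * clifford_C (\<mu> + 2) t)"
    by (subst (asm) sums_Suc_iff) (simp add: f_def)
  have "(\<lambda>m. (\<mu> + 1) * (clifford_term (\<mu> + 1) m * (- t) ^ m)) sums ((\<mu> + 1) * clifford_C (\<mu> + 1) t)"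
    using sums_mult[OF summable_sums[OF s[of "\<mu> + 1"]]] assms by (simp add: clifford_def)
  from sums_add[OF this f]
  have "(\<lambda>m. clifford_term \<mu> m * (- t) ^ m) sums ((\<mu> + 1) * clifford_C (\<mu> + 1) t - t * clifford_C (\<mu> + 2) t)"
    by (simp add: f_def clifford_term_shift[OF assms] algebra_simps)
  then show ?thesis
    by (simp add: clifford_def sums_iff)
qed

text \<open>
  The evaluation point is allowed to vary with \<open>n\<close>, because the limit is also taken along zeros of
  the approximants and of their derivatives.
\<close>

lemma clifford_tendsto:
  assumes "\<mu> > -1" and b: "\<And>n m. \<bar>b n m\<bar> \<le> 1" "\<And>m. (\<lambda>n. b n m) \<longlonglongrightarrow> 1"
    and \<xi>: "\<xi> \<longlonglongrightarrow> t"
  shows "(\<lambda>n. clifford (b n) \<mu> (\<xi> n)) \<longlonglongrightarrow> clifford_C \<mu> t"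
proof -
  from \<xi> have "Bseq \<xi>"
    by (intro convergent_imp_Bseq convergentI)
  then obtain K where K: "\<And>n. \<bar>\<xi> n\<bar> \<le> K"
    by (auto simp: Bseq_def)
  have "(\<lambda>n. \<Sum>m. b n m * clifford_term \<mu> m * (- \<xi> n) ^ m) \<longlonglongrightarrow> (\<Sum>m. 1 * clifford_term \<mu> m * (- t) ^ m)"
  proof (rule tannerys_theorem[THEN conjunct2, THEN conjunct2])
    show "(\<lambda>n. b n m * clifford_term \<mu> m * (- \<xi> n) ^ m) \<longlonglongrightarrow> 1 * clifford_term \<mu> m * (- t) ^ m" for m
      by (intro tendsto_intros b \<xi>)
    show "summable (\<lambda>m. clifford_term \<mu> m * K ^ m)"
      by (rule summable_clifford_term[OF assms(1)])
    show "\<forall>\<^sub>F (m, n) in sequentially \<times>\<^sub>F sequentially.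
            norm (b n m * clifford_term \<mu> m * (- \<xi> n) ^ m) \<le> clifford_term \<mu> m * K ^ m"
    proof (rule always_eventually, clarify)
      fix m n
      have "\<bar>b n m\<bar> * (clifford_term \<mu> m * \<bar>\<xi> n\<bar> ^ m) \<le> 1 * (clifford_term \<mu> m * K ^ m)"
        using clifford_term_pos[OF assms(1), of m] b(1)[of n m] K[of n]
        by (intro mult_mono mult_left_mono power_mono) auto
      then show "norm (b n m * clifford_term \<mu> m * (- \<xi> n) ^ m) \<le> clifford_term \<mu> m * K ^ m"
        using clifford_term_pos[OF assms(1), of m] by (simp add: abs_mult power_abs mult_ac)
    qed
  qed auto
  then show ?thesis
    by (simp add: clifford_def)
qed

lemma clifford_C_pos:
  assumes "\<mu> > -1" "t \<le> 0"
  shows "clifford_C \<mu> t > 0"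
proof -
  have "0 \<le> clifford_term \<mu> m * (- t) ^ m" for m
    using clifford_term_pos[OF assms(1), of m] assms(2) by simp
  then have "0 < (\<Sum>m. clifford_term \<mu> m * (- t) ^ m)"
    using clifford_term_pos[OF assms(1), of 0]
    by (intro suminf_pos2[where i = 0] summable_clifford_term assms(1)) auto
  then show ?thesis by (simp add: clifford_def)
qed

text \<open>
  For large order the constant term dominates: each further term is at most a third of its
  predecessor in absolute value.
\<close>

lemma clifford_C_pos_small:
  assumes "\<mu> > -1" "0 \<le> t" "3 * t \<le> \<mu> + 1"
  shows "clifford_C \<mu> t > 0"
proof -
  let ?c = "clifford_term \<mu>"
  let ?f = "\<lambda>m. ?c m * (- t) ^ m"
  have c: "?c m * t ^ m \<le> ?c 0 * (1/3) ^ m" for m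
  proof (induction m)
    case (Suc m)
    have "3 * t * 1 \<le> (real m + \<mu> + 1) * real (Suc m)"
      using assms by (intro mult_mono) auto
    then have "t / (real (Suc m) * (real m + \<mu> + 1)) \<le> 1 / 3"
      using assms(1) by (subst pos_divide_le_eq) (auto simp: mult_ac intro!: mult_pos_pos)
    then have "?c m * t ^ m * (t / (real (Suc m) * (real m + \<mu> + 1))) \<le> ?c 0 * (1/3) ^ m * (1 / 3)"
      using assms clifford_term_pos[OF assms(1)] by (intro mult_mono Suc.IH) (auto simp: less_imp_le)
    then show ?case
      by (simp add: clifford_term_Suc[OF assms(1)] mult_ac del: of_nat_Suc)
  qed simp
  have summ: "summable ?f"
    by (rule summable_clifford_term[OF assms(1)])
  have geo: "(\<lambda>m. ?c 0 * (1/3) ^ m * (1/3)) sums (?c 0 * (1 / (1 - 1/3)) * (1/3))"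
    by (intro sums_mult sums_mult2 geometric_sums) auto
  have "norm (\<Sum>m. ?f (Suc m)) \<le> (\<Sum>m. ?c 0 * (1/3) ^ m * (1/3))"
  proof (rule norm_suminf_le)
    show "norm (?f (Suc m)) \<le> ?c 0 * (1/3) ^ m * (1/3)" for m
      using c[of "Suc m"] assms(2) clifford_term_pos[OF assms(1), of "Suc m"]
      by (simp add: abs_mult power_abs)
  qed (use geo in \<open>simp add: sums_iff\<close>)
  also have "\<dots> = ?c 0 / 2"
    using geo by (simp add: sums_iff)
  finally have "norm (\<Sum>m. ?f (Suc m)) \<le> ?c 0 / 2" .
  moreover have "clifford_C \<mu> t = ?c 0 + (\<Sum>m. ?f (Suc m))"
    using suminf_split_head[OF summ] by (simp add: clifford_def)
  ultimately show ?thesis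
    using clifford_term_pos[OF assms(1), of 0] by (simp add: abs_le_iff)
qed

text \<open>
  The recurrence propagates a common zero to all higher orders \<open>\<mu> + k\<close>, which contradicts
  positivity for large \<open>k\<close>. Since the derivative of \<open>C\<^sub>\<mu>\<close> is \<open>- C\<^sub>\<mu>\<^sub>+\<^sub>1\<close>, this says that all
  positive zeros are simple.
\<close>

lemma clifford_C_no_common_zero:
  assumes "\<mu> > -1" "t > 0" "clifford_C \<mu> t = 0"
  shows "clifford_C (\<mu> + 1) t \<noteq> 0"
proof
  assume *: "clifford_C (\<mu> + 1) t = 0"
  have "clifford_C (\<mu> + real k) t = 0 \<and> clifford_C (\<mu> + real k + 1) t = 0" for k
  proof (induction k)
    case (Suc k)
    have "t * clifford_C (\<mu> + real k + 2) t = 0"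
      using clifford_C_recurrence[of "\<mu> + real k" t] assms(1) Suc.IH by simp
    then have "clifford_C (\<mu> + real k + 2) t = 0"
      using assms(2) by simp
    moreover have "\<mu> + real (Suc k) = \<mu> + real k + 1" "\<mu> + real (Suc k) + 1 = \<mu> + real k + 2"
      by simp_all
    ultimately show ?case
      using Suc.IH by (simp only: simp_thms)
  qed (use assms * in auto)
  moreover obtain k :: nat where "real k \<ge> 3 * t"
    using real_arch_simple by blast
  then have "clifford_C (\<mu> + real k) t > 0"
    using assms by (intro clifford_C_pos_small) auto
  ultimately show False
    by (metis less_irrefl)
qed

section \<open>Laguerre polynomials have distinct positive zeros\<close>

text \<open>
  The generalized Laguerre polynomial with parameter \<open>\<mu>\<close>, divided by
  \<open>Gamma (n + \<mu> + 1) / n!\<close>.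
\<close>

definition laguerre :: "nat \<Rightarrow> real \<Rightarrow> real poly" where
  "laguerre n \<mu> = (\<Sum>m\<le>n. monom ((-1) ^ m * real (n choose m) / Gamma (real m + \<mu> + 1)) m)"

lemma coeff_laguerre:
  "coeff (laguerre n \<mu>) m = (-1) ^ m * real (n choose m) / Gamma (real m + \<mu> + 1)"
  by (simp add: laguerre_def coeff_sum binomial_eq_0)

lemma degree_laguerre: "degree (laguerre n \<mu>) \<le> n"
  by (rule degree_le) (simp add: coeff_laguerre binomial_eq_0)

lemma laguerre_Suc:
  assumes "\<mu> > -1"
  shows "laguerre (Suc n) \<mu> =
    pCons 0 (pderiv (laguerre n (\<mu> + 1))) + smult (\<mu> + 1) (laguerre n (\<mu> + 1)) - pCons 0 (laguerre n (\<mu> + 1))"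
proof (rule poly_eqI)
  fix m
  have G: "Gamma (real k + (\<mu> + 1) + 1) = (real k + \<mu> + 1) * Gamma (real k + \<mu> + 1)" for k
  proof -
    have *: "real k + \<mu> + 1 \<notin> \<int>\<^sub>\<le>\<^sub>0"
      using assms by (auto dest!: nonpos_Ints_nonpos)
    show ?thesis
      using Gamma_plus1[OF *] by (simp add: add_ac)
  qed
  have quot: "(real k + \<mu> + 1) * (c / Gamma (real k + (\<mu> + 1) + 1)) = c / Gamma (real k + \<mu> + 1)" for k c
    unfolding G using assms by simp
  show "coeff (laguerre (Suc n) \<mu>) m = coeff (pCons 0 (pderiv (laguerre n (\<mu> + 1)))
          + smult (\<mu> + 1) (laguerre n (\<mu> + 1)) - pCons 0 (laguerre n (\<mu> + 1))) m"
  proof (cases m)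
    case 0
    then show ?thesis
      using quot[of 0 1] by (simp add: coeff_laguerre)
  next
    case (Suc j)
    let ?L = "laguerre n (\<mu> + 1)"
    have "coeff (pCons 0 (pderiv ?L) + smult (\<mu> + 1) ?L - pCons 0 ?L) m
        = real m * coeff ?L m + (\<mu> + 1) * coeff ?L m - coeff ?L j"
      by (simp add: Suc coeff_pderiv)
    also have "\<dots> = (real m + \<mu> + 1) * coeff ?L m - coeff ?L j"
      by (simp add: distrib_right)
    also have "\<dots> = (-1) ^ m * real (n choose m) / Gamma (real m + \<mu> + 1)
          + (-1) ^ m * real (n choose j) / Gamma (real m + \<mu> + 1)"
      unfolding coeff_laguerre quot by (simp add: Suc add_ac)
    also have "\<dots> = (-1) ^ m * real ((n choose m) + (n choose j)) / Gamma (real m + \<mu> + 1)"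
      by (simp add: distrib_left add_divide_distrib)
    finally show ?thesis
      by (simp only: coeff_laguerre Suc binomial_Suc_Suc add.commute)
  qed
qed

text \<open>
  One step of the Rodrigues formula. The weighted polynomial on the left vanishes at \<open>0\<close>, at the
  zeros of the polynomial and at infinity, which provides enough zeros of the derivative for an
  induction on the degree.
\<close>

lemma laguerre_weighted_derivative:
  assumes "\<mu> > -1" "x > 0"
  shows "((\<lambda>x. x powr (\<mu> + 1) * exp (- x) * poly (laguerre n (\<mu> + 1)) x) has_field_derivative
    x powr \<mu> * exp (- x) * poly (laguerre (Suc n) \<mu>) x) (at x)"
proof -
  have *: "x powr (\<mu> + 1) = x powr \<mu> * x"
    using assms by (simp add: powr_add)
  let ?L = "laguerre n (\<mu> + 1)"
  have "((\<lambda>x. x powr (\<mu> + 1)) has_field_derivative (\<mu> + 1) * x powr \<mu>) (at x)"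
    using has_real_derivative_powr[OF assms(2), of "\<mu> + 1"] by simp
  moreover have "((\<lambda>x. exp (- x)) has_field_derivative - exp (- x)) (at x)"
    by (auto intro!: derivative_eq_intros)
  ultimately have "((\<lambda>x. x powr (\<mu> + 1) * exp (- x) * poly ?L x) has_field_derivative
      ((\<mu> + 1) * x powr \<mu> * exp (- x) + - exp (- x) * x powr (\<mu> + 1)) * poly ?L x
      + poly (pderiv ?L) x * (x powr (\<mu> + 1) * exp (- x))) (at x)"
    by (intro DERIV_mult poly_DERIV)
  also have "((\<mu> + 1) * x powr \<mu> * exp (- x) + - exp (- x) * x powr (\<mu> + 1)) * poly ?L x
      + poly (pderiv ?L) x * (x powr (\<mu> + 1) * exp (- x))
      = x powr \<mu> * exp (- x) * poly (laguerre (Suc n) \<mu>) x"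
    unfolding laguerre_Suc[OF assms(1)] * by (simp add: algebra_simps)
  finally show ?thesis .
qed

lemma powr_exp_poly_tendsto_0:
  fixes p :: "real poly"
  assumes "a > 0"
  shows "((\<lambda>x. x powr a * exp (- x) * poly p x) \<longlongrightarrow> 0) at_top"
proof -
  have "((\<lambda>x. x powr a * exp (- x) * (c * x ^ i)) \<longlongrightarrow> 0) at_top" for c :: real and i
    using assms by real_asymp
  then have "((\<lambda>x. \<Sum>i\<le>degree p. x powr a * exp (- x) * (coeff p i * x ^ i)) \<longlongrightarrow> 0) at_top"
    by (intro tendsto_null_sum)
  then show ?thesis
    by (simp add: poly_altdef sum_distrib_left)
qed

text \<open>
  A sign change reduces the claim to a function that is positive somewhere; as it is smaller
  further out, it has an interior maximum.
\<close>

lemma Rolle_at_infinity: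
  fixes f f' :: "real \<Rightarrow> real"
  assumes cont: "continuous_on {a..} f" and "f a = 0" and lim: "(f \<longlongrightarrow> 0) at_top"
    and deriv: "\<And>x. x > a \<Longrightarrow> (f has_field_derivative f' x) (at x)"
  shows "\<exists>x>a. f' x = 0"
proof -
  have *: "\<exists>x>a. g' x = 0"
    if cont: "continuous_on {a..} g" and g: "g a = 0" "g (a + 1) > 0" and lim: "(g \<longlongrightarrow> 0) at_top"
      and deriv: "\<And>x. x > a \<Longrightarrow> (g has_field_derivative g' x) (at x)"
    for g g' :: "real \<Rightarrow> real"
  proof -
    have "eventually (\<lambda>x. g x < g (a + 1) \<and> x > a + 1) at_top"
      using order_tendstoD(2)[OF lim g(2)] eventually_gt_at_top by (rule eventually_conj)
    then obtain c where c: "g c < g (a + 1)" "c > a + 1"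
      using eventually_happens[of _ "at_top :: real filter"] by auto
    have "continuous_on {a..c} g"
      by (rule continuous_on_subset[OF cont]) auto
    then obtain x where x: "x \<in> {a..c}" and max: "\<And>y. y \<in> {a..c} \<Longrightarrow> g y \<le> g x"
      using continuous_attains_sup[of "{a..c}" g] c by force
    have "g x \<ge> g (a + 1)"
      using max[of "a + 1"] c by auto
    then have "x \<noteq> a" "x \<noteq> c"
      using g c by auto
    with x have "a < x" "x < c"
      by auto
    then have "g' x = 0"
      by (intro DERIV_local_max[OF deriv, of _ "min (x - a) (c - x)"])
         (auto simp: abs_if split: if_splits intro!: max)
    with \<open>a < x\<close> show ?thesis
      by blast
  qed
  consider "f (a + 1) = 0" | "f (a + 1) > 0" | "f (a + 1) < 0"
    by linarith
  then show ?thesis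
  proof cases
    case 1
    have "continuous_on {a..a + 1} f"
      by (rule continuous_on_subset[OF cont]) auto
    moreover have "f differentiable (at x)" if "a < x" for x
      using deriv[OF that] real_differentiable_def by blast
    ultimately obtain z where "a < z" "DERIV f z :> 0"
      using Rolle[of a "a + 1" f] 1 \<open>f a = 0\<close> by auto
    then show ?thesis
      using DERIV_unique deriv by blast
  next
    case 2
    then show ?thesis
      using *[of f f'] assms by blast
  next
    case 3
    have "\<exists>x>a. - f' x = 0"
    proof (rule *)
      show "((\<lambda>x. - f x) \<longlongrightarrow> 0) at_top"
        using tendsto_minus[OF lim] by simp
      show "continuous_on {a..} (\<lambda>x. - f x)"
        by (rule continuous_on_minus[OF cont])
      show "((\<lambda>x. - f x) has_field_derivative - f' x) (at x)" if "x > a" for x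
        by (rule DERIV_minus[OF deriv[OF that]])
    qed (use 3 \<open>f a = 0\<close> in auto)
    then show ?thesis by simp
  qed
qed

lemma laguerre_roots:
  assumes "\<mu> > -1"
  shows "\<exists>s. (\<forall>i<n. s i > 0 \<and> poly (laguerre n \<mu>) (s i) = 0) \<and> (\<forall>i j. i < j \<longrightarrow> j < n \<longrightarrow> s i < (s j :: real))"
  using assms
proof (induction n arbitrary: \<mu>)
  case (Suc n)
  from Suc.IH[of "\<mu> + 1"] Suc.prems obtain s
    where s: "\<And>i. i < n \<Longrightarrow> s i > 0 \<and> poly (laguerre n (\<mu> + 1)) (s i) = 0"
      and mono: "\<And>i j. i < j \<Longrightarrow> j < n \<Longrightarrow> s i < s j"
    by auto
  define f where "f x = x powr (\<mu> + 1) * exp (- x) * poly (laguerre n (\<mu> + 1)) x" for x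
  define f' where "f' x = x powr \<mu> * exp (- x) * poly (laguerre (Suc n) \<mu>) x" for x
  (* The zeros of f that Rolle's theorem is applied to: the origin, followed by the s j. *)
  define r where "r i = (case i of 0 \<Rightarrow> 0 | Suc j \<Rightarrow> s j)" for i
  have r0: "r 0 = 0" and rS: "r (Suc j) = s j" for j
    by (simp_all add: r_def)
  have r_nonneg: "r i \<ge> 0" if "i \<le> n" for i
    using that s by (cases i) (auto simp: r0 rS less_imp_le)
  have r_zero: "f (r i) = 0" if "i \<le> n" for i
    using that s Suc.prems by (cases i) (auto simp: r0 rS f_def)
  have r_step: "r i < r (Suc i)" if "i < n" for i
    using that s mono by (cases i) (auto simp: r0 rS)
  have f': "(f has_field_derivative f' x) (at x)" if "x > 0" for x
    unfolding f_def f'_def using laguerre_weighted_derivative[of \<mu> x n] that Suc.prems by simp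
  have cont: "continuous_on {a..} f" if "a \<ge> 0" for a
    unfolding f_def using that Suc.prems by (intro continuous_intros continuous_on_powr') auto
  have "\<exists>x. r i < x \<and> f' x = 0 \<and> (i < n \<longrightarrow> x < r (Suc i))" if i: "i \<le> n" for i
  proof (cases "i < n")
    case True
    have "continuous_on {r i..r (Suc i)} f"
      by (rule continuous_on_subset[OF cont[OF r_nonneg[OF i]]]) auto
    moreover have "f differentiable (at x)" if "r i < x" for x
      using f'[of x] that r_nonneg[OF i] real_differentiable_def by force
    ultimately obtain z where "r i < z" "z < r (Suc i)" "DERIV f z :> 0"
      using Rolle[OF r_step[OF True], of f] r_zero[OF i] r_zero[of "Suc i"] True by auto
    moreover from this have "f' z = 0"
      using f'[of z] r_nonneg[OF i] DERIV_unique by fastforce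
    ultimately show ?thesis by blast
  next
    case False
    have "\<exists>x>r i. f' x = 0"
    proof (rule Rolle_at_infinity)
      show "(f \<longlongrightarrow> 0) at_top"
        unfolding f_def using Suc.prems by (intro powr_exp_poly_tendsto_0) auto
    qed (use that r_nonneg[of i] r_zero cont f' in auto)
    with False show ?thesis by blast
  qed
  then obtain z where z: "\<And>i. i \<le> n \<Longrightarrow> r i < z i \<and> f' (z i) = 0 \<and> (i < n \<longrightarrow> z i < r (Suc i))"
    by metis
  have r_mono: "r i \<le> r j" if "i \<le> j" "j \<le> n" for i j
    using that
  proof (induction j rule: dec_induct)
    case (step k)
    then show ?case using r_step[of k] by auto
  qed simp
  have "z i < z j" if "i < j" "j < Suc n" for i j
    using z[of i] z[of j] r_mono[of "Suc i" j] that by auto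
  moreover have z_pos: "z i > 0" if "i < Suc n" for i
    using z[of i] r_nonneg[of i] that by auto
  moreover have "poly (laguerre (Suc n) \<mu>) (z i) = 0" if "i < Suc n" for i
    using z[of i] that z_pos[OF that] by (auto simp: f'_def)
  ultimately show ?case
    by (intro exI[of _ z]) auto
qed auto

section \<open>Laguerre approximants of the Bessel-Clifford function\<close>

text \<open>
  \<open>damping n m\<close> is the product of the factors \<open>1 - i / (n + 1)\<close> for \<open>i < m\<close>; it vanishes for
  \<open>m > n + 1\<close>. These weights turn \<open>C\<^sub>\<mu>\<close> into a rescaled Laguerre polynomial.
\<close>

definition damping :: "nat \<Rightarrow> nat \<Rightarrow> real" where
  "damping n m = real (Suc n choose m) * fact m / real (Suc n) ^ m"

lemma abs_damping_le_1: "\<bar>damping n m\<bar> \<le> 1"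
proof -
  have "real ((Suc n choose m) * fact m) \<le> real (Suc n ^ m)"
    using binomial_fact_pow[of "Suc n" m] of_nat_le_iff by blast
  then show ?thesis
    by (simp add: damping_def divide_le_eq del: of_nat_Suc binomial_Suc_Suc)
qed

lemma damping_0 [simp]: "damping n 0 = 1" and damping_1 [simp]: "damping n (Suc 0) = 1"
  by (simp_all add: damping_def)

lemma damping_tendsto_1: "(\<lambda>n. damping n m) \<longlonglongrightarrow> 1"
proof -
  have "damping n m = (\<Prod>i<m. (real (Suc n) - real i) / real (Suc n))" for n
    by (simp add: damping_def binomial_gbinomial gbinomial_prod_rev prod_dividef atLeast0LessThan
        del: of_nat_Suc binomial_Suc_Suc)
  moreover have "(\<lambda>n. \<Prod>i<m. (real (Suc n) - real i) / real (Suc n)) \<longlonglongrightarrow> (\<Prod>i<m. 1)"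
  proof (rule tendsto_prod)
    fix i show "(\<lambda>n. (real (Suc n) - real i) / real (Suc n)) \<longlonglongrightarrow> 1"
      by real_asymp
  qed
  ultimately show ?thesis
    by simp
qed

lemma clifford_damping_conv_laguerre:
  "clifford (damping n) \<mu> t = poly (laguerre (Suc n) \<mu>) (t / real (Suc n))"
proof -
  let ?q = "\<lambda>m. (-1) ^ m * real (Suc n choose m) / Gamma (real m + \<mu> + 1) * (t / real (Suc n)) ^ m"
  have eq: "damping n m * clifford_term \<mu> m * (- t) ^ m = ?q m" for m
    by (simp add: damping_def clifford_term_def power_divide power_minus[of t] mult_ac
        del: of_nat_Suc binomial_Suc_Suc)
  have "clifford (damping n) \<mu> t = (\<Sum>m\<le>Suc n. ?q m)"
    unfolding clifford_def eq by (rule suminf_finite) (auto simp: binomial_eq_0)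
  also have "\<dots> = poly (laguerre (Suc n) \<mu>) (t / real (Suc n))"
    by (simp only: laguerre_def poly_sum poly_monom)
  finally show ?thesis .
qed

text \<open>
  Both sides have degree at most \<open>n\<close> and agree at \<open>0\<close> and at the \<open>n\<close> zeros.
\<close>

lemma laguerre_factorization:
  assumes "\<mu> > -1"
    and root: "\<And>i. i < n \<Longrightarrow> s i > 0" "\<And>i. i < n \<Longrightarrow> poly (laguerre n \<mu>) (s i) = 0"
    and mono: "\<And>i j. i < j \<Longrightarrow> j < n \<Longrightarrow> s i < s j"
  shows "laguerre n \<mu> = smult (1 / Gamma (\<mu> + 1)) (\<Prod>i<n. [:1, - (1 / s i):])"
proof (rule poly_eqI_degree[where A = "insert 0 (s ` {..<n})"])
  have "inj_on s {..<n}"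
    by (rule inj_onI) (metis lessThan_iff mono less_irrefl linorder_neqE_nat)
  moreover have "0 \<notin> s ` {..<n}"
    using root(1) by force
  ultimately have card: "card (insert 0 (s ` {..<n})) = Suc n"
    by (simp add: card_image)
  show "degree (laguerre n \<mu>) < card (insert 0 (s ` {..<n}))"
    using degree_laguerre[of n \<mu>] card by simp
  have "degree (\<Prod>i<n. [:1, - (1 / s i):]) \<le> (\<Sum>i<n. degree [:1, - (1 / s i):])"
    using degree_prod_sum_le[of "{..<n}" "\<lambda>i. [:1, - (1 / s i):]"] by (simp add: o_def)
  also have "\<dots> \<le> (\<Sum>i<n. 1)"
    by (intro sum_mono) auto
  finally have "degree (\<Prod>i<n. [:1, - (1 / s i):]) \<le> n"
    by simp
  then show "degree (smult (1 / Gamma (\<mu> + 1)) (\<Prod>i<n. [:1, - (1 / s i):])) < card (insert 0 (s ` {..<n}))"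
    using card le_trans[OF degree_smult_le] by (metis less_Suc_eq_le)
  fix x assume "x \<in> insert 0 (s ` {..<n})"
  then consider "x = 0" | i where "i < n" "x = s i"
    by auto
  then show "poly (laguerre n \<mu>) x = poly (smult (1 / Gamma (\<mu> + 1)) (\<Prod>i<n. [:1, - (1 / s i):])) x"
  proof cases
    case 1
    have "poly (laguerre n \<mu>) 0 = 1 / Gamma (\<mu> + 1)"
      by (simp add: poly_0_coeff_0 coeff_laguerre)
    with 1 show ?thesis
      by (simp add: poly_prod)
  next
    case 2
    have "(\<Prod>j<n. 1 - s i * (1 / s j)) = 0"
      using 2 root(1)[of i] by (intro prod_zero) (auto intro!: bexI[of _ i])
    with 2 show ?thesis
      by (simp add: root(2) poly_prod)
  qed
qed

lemma clifford_damping_factorization: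
  assumes "\<mu> > -1"
  shows "\<exists>x. (\<forall>k>n. x k = 0) \<and> (\<forall>k\<le>n. 0 < x k) \<and> (\<forall>i j. i < j \<longrightarrow> j \<le> n \<longrightarrow> x j < x i) \<and>
    (\<forall>t. clifford (damping n) \<mu> t = clifford_term \<mu> 0 * (\<Prod>k\<le>n. 1 - t * x k))"
proof -
  obtain s where s: "\<And>i. i < Suc n \<Longrightarrow> s i > 0" "\<And>i. i < Suc n \<Longrightarrow> poly (laguerre (Suc n) \<mu>) (s i) = 0"
      and mono: "\<And>i j. i < j \<Longrightarrow> j < Suc n \<Longrightarrow> s i < (s j :: real)"
    using laguerre_roots[OF assms, of "Suc n"] by blast
  define x where "x k = (if k \<le> n then 1 / (real (Suc n) * s k) else 0)" for k
  have "laguerre (Suc n) \<mu> = smult (1 / Gamma (\<mu> + 1)) (\<Prod>i<Suc n. [:1, - (1 / s i):])"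
    by (rule laguerre_factorization[OF assms]) (use s mono in auto)
  then have "clifford (damping n) \<mu> t = clifford_term \<mu> 0 * (\<Prod>k\<le>n. 1 - t * x k)" for t
    unfolding clifford_damping_conv_laguerre
    by (simp add: poly_prod x_def lessThan_Suc_atMost clifford_term_def mult_ac cong: prod.cong_simp del: of_nat_Suc prod.lessThan_Suc)
  moreover have "x j < x i" if "i < j" "j \<le> n" for i j
    using that s(1)[of i] s(1)[of j] mono[of i j]
    by (simp add: x_def del: of_nat_Suc) (intro divide_strict_left_mono mult_strict_left_mono mult_pos_pos, auto)
  moreover have "0 < x k" if "k \<le> n" for k
    using that s(1)[of k] by (simp add: x_def del: of_nat_Suc)
  moreover have "x k = 0" if "k > n" for k
    using that by (simp add: x_def)
  ultimately have "(\<forall>k>n. x k = 0) \<and> (\<forall>k\<le>n. 0 < x k) \<and> (\<forall>i j. i < j \<longrightarrow> j \<le> n \<longrightarrow> x j < x i) \<and>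
    (\<forall>t. clifford (damping n) \<mu> t = clifford_term \<mu> 0 * (\<Prod>k\<le>n. 1 - t * x k))"
    by blast
  then show ?thesis by blast
qed

text \<open>
  The signs are chosen for Bessel-Clifford functions, where each derivative is minus the next
  function.
\<close>

lemma logarithmic_derivatives_of_product:
  fixes D0 D1 :: "real \<Rightarrow> real" and n :: nat
  assumes D0: "\<And>t. D0 t = C * (\<Prod>k\<le>n. 1 - t * x k)"
    and D1: "\<And>t. (D0 has_field_derivative - D1 t) (at t)"
    and D2: "(D1 has_field_derivative - D2) (at t)"
    and nz: "D0 t \<noteq> 0"
  shows "(\<Sum>k\<le>n. x k / (1 - t * x k)) = D1 t / D0 t"
    and "(\<Sum>k\<le>n. (x k)\<^sup>2 / (1 - t * x k)\<^sup>2) = (D1 t / D0 t)\<^sup>2 - D2 / D0 t"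
proof -
  define g where "g t = (\<Sum>k\<le>n. x k / (1 - t * x k))" for t
  have fac: "1 - u * x k \<noteq> 0" if "D0 u \<noteq> 0" "k \<le> n" for u k
    using that unfolding D0 by (auto simp: prod_zero_iff simp del: eq_iff_diff_eq_0)
  have first: "D1 u = D0 u * g u" if "D0 u \<noteq> 0" for u
  proof -
    have "((\<lambda>u. \<Prod>k\<in>{..n}. 1 - u * x k) has_field_derivative (\<Prod>k\<in>{..n}. 1 - u * x k) * (\<Sum>k\<in>{..n}. - x k / (1 - u * x k))) (at u)"
      by (rule has_field_derivative_prod') (use fac[OF that] in \<open>auto intro!: derivative_eq_intros\<close>)
    then have "(D0 has_field_derivative C * ((\<Prod>k\<in>{..n}. 1 - u * x k) * (\<Sum>k\<in>{..n}. - x k / (1 - u * x k)))) (at u)"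
      unfolding D0[abs_def] by (rule DERIV_cmult)
    from DERIV_unique[OF this D1] show ?thesis
      by (simp add: D0 g_def sum_negf)
  qed
  show "g t = D1 t / D0 t"
    using first[OF nz] nz by simp
  have cont: "continuous_on UNIV D0"
    using D1 by (meson DERIV_continuous continuous_at_imp_continuous_on)
  have "open {u. D0 u \<noteq> 0}"
    using open_Collect_neq[OF cont continuous_on_const] by simp
  have "(g has_field_derivative (\<Sum>k\<le>n. (x k)\<^sup>2 / (1 - t * x k)\<^sup>2)) (at t)"
    unfolding g_def using fac[OF nz]
    by (intro DERIV_sum) (auto intro!: derivative_eq_intros simp: power2_eq_square)
  from DERIV_mult[OF D1 this]
  have "((\<lambda>u. D0 u * g u) has_field_derivative
      - D1 t * g t + (\<Sum>k\<le>n. (x k)\<^sup>2 / (1 - t * x k)\<^sup>2) * D0 t) (at t)" .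
  then have "(D1 has_field_derivative - D1 t * g t + (\<Sum>k\<le>n. (x k)\<^sup>2 / (1 - t * x k)\<^sup>2) * D0 t) (at t)"
    by (rule has_field_derivative_transform_within_open[OF _ \<open>open _\<close>]) (use nz first in auto)
  from DERIV_unique[OF this D2]
  show "(\<Sum>k\<le>n. (x k)\<^sup>2 / (1 - t * x k)\<^sup>2) = (D1 t / D0 t)\<^sup>2 - D2 / D0 t"
    using nz first[OF nz] by (simp add: field_simps power2_eq_square)
qed

section \<open>Passage to the limit\<close>

text \<open>
  Row \<open>n\<close> of \<open>Y\<close> lists the reciprocal zeros of the approximant with index \<open>\<phi> n\<close> in decreasing
  order, continued by \<open>0\<close>. The reindexing \<open>\<phi>\<close> is the identity when the bounds that allow the
  choice of a convergent subsequence are derived, and that subsequence afterwards.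
\<close>

locale clifford_approximation =
  fixes \<mu> :: real and \<phi> :: "nat \<Rightarrow> nat" and Y :: "nat \<Rightarrow> nat \<Rightarrow> real"
  assumes order: "\<mu> > -1" and subseq: "strict_mono \<phi>"
    and Y_beyond: "\<And>n k. k > \<phi> n \<Longrightarrow> Y n k = 0"
    and Y_pos: "\<And>n k. k \<le> \<phi> n \<Longrightarrow> 0 < Y n k"
    and Y_decreasing: "\<And>n i j. i < j \<Longrightarrow> j \<le> \<phi> n \<Longrightarrow> Y n j < Y n i"
    and factorization: "\<And>n t. clifford (damping (\<phi> n)) \<mu> t = clifford_term \<mu> 0 * (\<Prod>k\<le>\<phi> n. 1 - t * Y n k)"
begin

definition approx0 :: "nat \<Rightarrow> real \<Rightarrow> real" where
  "approx0 n = clifford (damping (\<phi> n)) \<mu>"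

definition approx1 :: "nat \<Rightarrow> real \<Rightarrow> real" where
  "approx1 n = clifford (\<lambda>m. damping (\<phi> n) (Suc m)) (\<mu> + 1)"

definition approx2 :: "nat \<Rightarrow> real \<Rightarrow> real" where
  "approx2 n = clifford (\<lambda>m. damping (\<phi> n) (Suc (Suc m))) (\<mu> + 2)"

lemma DERIV_approx0: "(approx0 n has_field_derivative - approx1 n t) (at t)"
  unfolding approx0_def approx1_def using order abs_damping_le_1 by (intro has_derivative_clifford) auto

lemma DERIV_approx1: "(approx1 n has_field_derivative - approx2 n t) (at t)"
  using has_derivative_clifford[of "\<mu> + 1" "\<lambda>m. damping (\<phi> n) (Suc m)" t] order abs_damping_le_1
  by (simp add: approx1_def approx2_def add.assoc)

lemma approx_tendsto:
  assumes "\<xi> \<longlonglongrightarrow> t"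
  shows "(\<lambda>n. approx0 n (\<xi> n)) \<longlonglongrightarrow> clifford_C \<mu> t"
    and "(\<lambda>n. approx1 n (\<xi> n)) \<longlonglongrightarrow> clifford_C (\<mu> + 1) t"
    and "(\<lambda>n. approx2 n (\<xi> n)) \<longlonglongrightarrow> clifford_C (\<mu> + 2) t"
proof -
  have d: "(\<lambda>n. damping (\<phi> n) m) \<longlonglongrightarrow> 1" for m
    using LIMSEQ_subseq_LIMSEQ[OF damping_tendsto_1 subseq] by (simp add: o_def)
  show "(\<lambda>n. approx0 n (\<xi> n)) \<longlonglongrightarrow> clifford_C \<mu> t"
    and "(\<lambda>n. approx1 n (\<xi> n)) \<longlonglongrightarrow> clifford_C (\<mu> + 1) t"
    and "(\<lambda>n. approx2 n (\<xi> n)) \<longlonglongrightarrow> clifford_C (\<mu> + 2) t"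
    unfolding approx0_def approx1_def approx2_def
    by (rule clifford_tendsto[OF _ _ _ assms]; use order abs_damping_le_1 d in simp)+
qed

lemma approx0_product: "approx0 n t = clifford_term \<mu> 0 * (\<Prod>k\<le>\<phi> n. 1 - t * Y n k)"
  by (simp add: approx0_def factorization)

lemma approx0_eq_0_iff: "approx0 n t = 0 \<longleftrightarrow> (\<exists>k\<le>\<phi> n. t * Y n k = 1)"
  using clifford_term_pos[OF order, of 0] by (auto simp: approx0_product prod_zero_iff)

lemma Y_nonneg: "0 \<le> Y n k"
  using Y_pos[of k n] Y_beyond[of n k] by (cases "k \<le> \<phi> n") auto

lemma approx_log_derivatives:
  assumes "approx0 n t \<noteq> 0"
  shows "(\<Sum>k\<le>\<phi> n. Y n k / (1 - t * Y n k)) = approx1 n t / approx0 n t"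
    and "(\<Sum>k\<le>\<phi> n. (Y n k)\<^sup>2 / (1 - t * Y n k)\<^sup>2)
      = (approx1 n t / approx0 n t)\<^sup>2 - approx2 n t / approx0 n t"
  by (rule logarithmic_derivatives_of_product[OF approx0_product DERIV_approx0 DERIV_approx1 assms])+

text \<open>
  The sum of the reciprocal zeros is read off from the two lowest coefficients, which the damping
  leaves unchanged; hence it is the same for all approximants.
\<close>

lemma sum_Y: "(\<Sum>k\<le>\<phi> n. Y n k) = 1 / (\<mu> + 1)"
proof -
  have 0: "approx0 n 0 = clifford_term \<mu> 0" "approx1 n 0 = clifford_term (\<mu> + 1) 0"
    by (simp_all add: approx0_def approx1_def clifford_at_0)
  with approx_log_derivatives(1)[of n 0] clifford_term_pos[OF order, of 0] show ?thesis
    by (simp add: clifford_term_0_ratio[OF order])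
qed

text \<open>
  The first \<open>k + 1\<close> entries of the row are at least \<open>Y n k\<close>, and the row sums to
  \<open>1 / (\<mu> + 1)\<close>.
\<close>

lemma Y_le: "Y n k \<le> 1 / (\<mu> + 1) / (real k + 1)"
proof (cases "k \<le> \<phi> n")
  case True
  have "(\<Sum>j\<le>k. Y n k) \<le> (\<Sum>j\<le>k. Y n j)"
  proof (intro sum_mono)
    fix j assume "j \<in> {..k}"
    then show "Y n k \<le> Y n j"
      using Y_decreasing[of j k n] True by (cases "j = k") auto
  qed
  also have "\<dots> \<le> (\<Sum>j\<le>\<phi> n. Y n j)"
    using True Y_nonneg by (intro sum_mono2) auto
  finally have "Y n k * (real k + 1) \<le> 1 / (\<mu> + 1)"
    by (simp add: sum_Y algebra_simps)
  then show ?thesis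
    by (subst pos_le_divide_eq) auto
qed (use Y_beyond[of n k] order in auto)

end

locale clifford_convergent_approximation = clifford_approximation +
  fixes x :: "nat \<Rightarrow> real"
  assumes Y_tendsto: "\<And>k. (\<lambda>n. Y n k) \<longlonglongrightarrow> x k"
begin

lemma x_nonneg: "0 \<le> x k"
  using Y_tendsto[of k] by (rule LIMSEQ_le_const) (use Y_nonneg in auto)

lemma x_le: "x k \<le> 1 / (\<mu> + 1) / (real k + 1)"
  using Y_tendsto[of k] by (rule LIMSEQ_le_const2) (use Y_le in auto)

lemma sum_x_le: "(\<Sum>k<N. x k) \<le> 1 / (\<mu> + 1)"
proof (rule LIMSEQ_le_const2)
  show "(\<lambda>n. \<Sum>k<N. Y n k) \<longlonglongrightarrow> (\<Sum>k<N. x k)"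
    by (intro tendsto_sum Y_tendsto)
  have "(\<Sum>k<N. Y n k) \<le> (\<Sum>k\<le>\<phi> n. Y n k)" for n
  proof -
    have "(\<Sum>k<N. Y n k) \<le> (\<Sum>k\<in>{..<N} \<union> {..\<phi> n}. Y n k)"
      using Y_nonneg by (intro sum_mono2) auto
    also have "\<dots> = (\<Sum>k\<le>\<phi> n. Y n k)"
      using Y_beyond by (intro sum.mono_neutral_right) auto
    finally show ?thesis .
  qed
  then show "\<exists>M. \<forall>n\<ge>M. (\<Sum>k<N. Y n k) \<le> 1 / (\<mu> + 1)"
    using sum_Y by auto
qed

text \<open>
  The entries with large index are uniformly small and thus stay away from \<open>1 / t\<close>; the finitely
  many others converge to limits different from \<open>1 / t\<close>.
\<close>

lemma eventually_separated:
  assumes "\<And>k. t * x k \<noteq> 1"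
  obtains \<delta> where "\<delta> > 0" "\<forall>\<^sub>F n in sequentially. \<forall>k. \<delta> \<le> \<bar>1 - t * Y n k\<bar>"
proof -
  define \<sigma> where "\<sigma> = 1 / (\<mu> + 1)"
  obtain K :: nat where K: "2 * (\<bar>t\<bar> * \<sigma>) \<le> real K"
    using real_arch_simple by blast
  have far: "1 / 2 \<le> \<bar>1 - t * Y n k\<bar>" if "k \<ge> K" for n k
  proof -
    have "\<bar>t\<bar> * Y n k \<le> \<bar>t\<bar> * (\<sigma> / (real k + 1))"
      using Y_le[of n k] by (intro mult_left_mono) (auto simp: \<sigma>_def)
    also have "\<dots> \<le> 1 / 2"
      using K that by (simp add: field_simps)
    finally have "\<bar>t * Y n k\<bar> \<le> 1 / 2"
      using Y_nonneg[of n k] by (simp add: abs_mult)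
    then show ?thesis by linarith
  qed
  define \<delta> where "\<delta> = Min (insert (1/2) ((\<lambda>k. \<bar>1 - t * x k\<bar> / 2) ` {..<K}))"
  have "\<delta> > 0"
    unfolding \<delta>_def using assms by (subst Min_gr_iff) force+
  have "\<forall>\<^sub>F n in sequentially. \<forall>k\<in>{..<K}. \<bar>1 - t * x k\<bar> / 2 < \<bar>1 - t * Y n k\<bar>"
  proof (rule eventually_ball_finite; safe)
    fix k
    have "(\<lambda>n. \<bar>1 - t * Y n k\<bar>) \<longlonglongrightarrow> \<bar>1 - t * x k\<bar>"
      by (intro tendsto_intros Y_tendsto)
    then show "\<forall>\<^sub>F n in sequentially. \<bar>1 - t * x k\<bar> / 2 < \<bar>1 - t * Y n k\<bar>"
      by (rule order_tendstoD) (use assms[of k] in auto)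
  qed
  then have "\<forall>\<^sub>F n in sequentially. \<forall>k. \<delta> \<le> \<bar>1 - t * Y n k\<bar>"
  proof eventually_elim
    case (elim n)
    show ?case
    proof
      fix k
      show "\<delta> \<le> \<bar>1 - t * Y n k\<bar>"
      proof (cases "k < K")
        case True
        then have "\<delta> \<le> \<bar>1 - t * x k\<bar> / 2"
          unfolding \<delta>_def by (intro Min_le) auto
        with elim True show ?thesis by force
      next
        case False
        have "\<delta> \<le> 1 / 2"
          unfolding \<delta>_def by (intro Min_le) auto
        with far[of k n] False show ?thesis by auto
      qed
    qed
  qed
  with \<open>\<delta> > 0\<close> show ?thesis by (rule that)
qed

lemma approx0_eq_0_eventually:
  assumes "x k > 0"
  shows "\<forall>\<^sub>F n in sequentially. k \<le> \<phi> n \<and> 0 < Y n k \<and> approx0 n (inverse (Y n k)) = 0"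
proof -
  have "\<forall>\<^sub>F n in sequentially. Y n k > 0"
    using Y_tendsto assms by (rule order_tendstoD)
  then show ?thesis
  proof eventually_elim
    case (elim n)
    then have "k \<le> \<phi> n"
      using Y_beyond[of n k] by (metis less_irrefl not_le)
    with elim show ?case
      by (auto simp: approx0_eq_0_iff intro!: exI[of _ k])
  qed
qed

lemma inverse_x_is_zero:
  assumes "x k > 0"
  shows "clifford_C \<mu> (inverse (x k)) = 0"
proof -
  have "(\<lambda>n. inverse (Y n k)) \<longlonglongrightarrow> inverse (x k)"
    using assms by (intro tendsto_inverse Y_tendsto) auto
  then have "(\<lambda>n. approx0 n (inverse (Y n k))) \<longlonglongrightarrow> clifford_C \<mu> (inverse (x k))"
    by (rule approx_tendsto)
  moreover have "(\<lambda>n. approx0 n (inverse (Y n k))) \<longlonglongrightarrow> 0"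
    using approx0_eq_0_eventually[OF assms] by (intro tendsto_eventually) (auto elim: eventually_mono)
  ultimately show ?thesis
    by (rule LIMSEQ_unique)
qed

text \<open>
  No zero is lost in the limit: if \<open>1 / t\<close> were not a limit of reciprocal zeros, the logarithmic
  derivatives of the approximants at \<open>t\<close> would stay bounded by a constant \<open>K\<close>, so that
  \<open>\<bar>C\<^sub>\<mu>\<^sub>+\<^sub>1(t)\<bar> \<le> K \<bar>C\<^sub>\<mu>(t)\<bar> = 0\<close> and \<open>t\<close> would be a common zero.
\<close>

lemma clifford_C_zero_iff: "clifford_C \<mu> t = 0 \<longleftrightarrow> (\<exists>k. t * x k = 1)"
proof
  assume "\<exists>k. t * x k = 1"
  then obtain k where k: "t * x k = 1" ..
  then have "x k \<noteq> 0" by auto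
  with x_nonneg[of k] have "x k > 0" by simp
  moreover from k have "t = inverse (x k)"
    by (metis inverse_inverse_eq inverse_unique mult.commute)
  ultimately show "clifford_C \<mu> t = 0"
    using inverse_x_is_zero by simp
next
  assume zero: "clifford_C \<mu> t = 0"
  then have "t > 0"
    using clifford_C_pos[OF order, of t] by fastforce
  show "\<exists>k. t * x k = 1"
  proof (rule ccontr)
    assume "\<nexists>k. t * x k = 1"
    then obtain \<delta> where \<delta>: "\<delta> > 0" "\<forall>\<^sub>F n in sequentially. \<forall>k. \<delta> \<le> \<bar>1 - t * Y n k\<bar>"
      using eventually_separated[of t] by metis
    from \<delta>(2) have "\<forall>\<^sub>F n in sequentially. \<bar>approx1 n t\<bar> \<le> 1 / (\<mu> + 1) / \<delta> * \<bar>approx0 n t\<bar>"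
    proof eventually_elim
      case (elim n)
      have "t * Y n k \<noteq> 1" for k
        using elim[rule_format, of k] \<delta>(1) by auto
      then have nz: "approx0 n t \<noteq> 0"
        by (simp add: approx0_eq_0_iff)
      have "\<bar>approx1 n t / approx0 n t\<bar> \<le> (\<Sum>k\<le>\<phi> n. \<bar>Y n k / (1 - t * Y n k)\<bar>)"
        unfolding approx_log_derivatives(1)[OF nz, symmetric] by (rule sum_abs)
      also have "\<dots> \<le> (\<Sum>k\<le>\<phi> n. Y n k / \<delta>)"
        using elim \<delta>(1) Y_nonneg by (intro sum_mono) (simp add: abs_divide frac_le)
      also have "\<dots> = 1 / (\<mu> + 1) / \<delta>"
        by (simp add: sum_divide_distrib[symmetric] sum_Y)
      finally show ?case
        using nz by (simp add: abs_divide pos_divide_le_eq)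
    qed
    then have "\<bar>clifford_C (\<mu> + 1) t\<bar> \<le> 1 / (\<mu> + 1) / \<delta> * \<bar>clifford_C \<mu> t\<bar>"
    proof (rule tendsto_le[OF sequentially_bot, rotated 2])
      note ap = approx_tendsto[OF tendsto_const[of t]]
      show "(\<lambda>n. \<bar>approx1 n t\<bar>) \<longlonglongrightarrow> \<bar>clifford_C (\<mu> + 1) t\<bar>"
        by (intro tendsto_rabs ap)
      show "(\<lambda>n. 1 / (\<mu> + 1) / \<delta> * \<bar>approx0 n t\<bar>) \<longlonglongrightarrow> 1 / (\<mu> + 1) / \<delta> * \<bar>clifford_C \<mu> t\<bar>"
        by (intro tendsto_mult_left tendsto_rabs ap)
    qed
    with zero clifford_C_no_common_zero[OF order \<open>t > 0\<close>] show False
      by simp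
  qed
qed

text \<open>
  If two zeros of the approximants merged in the limit, the zeros of the derivatives between them
  would converge to the same point, which would be a multiple zero of \<open>C\<^sub>\<mu>\<close>.
\<close>

lemma x_distinct:
  assumes "i < j" "x j > 0"
  shows "x i \<noteq> x j"
proof
  assume eq: "x i = x j"
  let ?a = "\<lambda>n. inverse (Y n i)" and ?b = "\<lambda>n. inverse (Y n j)"
  have "\<forall>\<^sub>F n in sequentially. \<exists>z. ?a n < z \<and> z < ?b n \<and> approx1 n z = 0"
    using approx0_eq_0_eventually[OF assms(2)] approx0_eq_0_eventually[of i, unfolded eq, OF assms(2)]
  proof eventually_elim
    case (elim n)
    have "?a n < ?b n"
      using elim Y_decreasing[OF assms(1), of n] by auto
    moreover have "continuous_on {?a n..?b n} (approx0 n)"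
      using DERIV_approx0 by (intro DERIV_atLeastAtMost_imp_continuous_on) blast
    moreover have "approx0 n differentiable (at z)" for z
      using DERIV_approx0 real_differentiable_def by blast
    ultimately obtain z where "?a n < z" "z < ?b n" "DERIV (approx0 n) z :> 0"
      using Rolle[of "?a n" "?b n" "approx0 n"] elim by auto
    with DERIV_unique[OF _ DERIV_approx0] show ?case
      by fastforce
  qed
  then obtain \<xi> where \<xi>: "\<forall>\<^sub>F n in sequentially. ?a n < \<xi> n \<and> \<xi> n < ?b n \<and> approx1 n (\<xi> n) = 0"
    unfolding eventually_ex ..
  have "\<xi> \<longlonglongrightarrow> inverse (x j)"
  proof (rule real_tendsto_sandwich)
    show "?a \<longlonglongrightarrow> inverse (x j)" "?b \<longlonglongrightarrow> inverse (x j)"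
      using tendsto_inverse[OF Y_tendsto[of i]] tendsto_inverse[OF Y_tendsto[of j]] assms(2) eq by auto
  qed (use \<xi> in \<open>auto elim: eventually_mono\<close>)
  then have "(\<lambda>n. approx1 n (\<xi> n)) \<longlonglongrightarrow> clifford_C (\<mu> + 1) (inverse (x j))"
    by (rule approx_tendsto)
  moreover have "(\<lambda>n. approx1 n (\<xi> n)) \<longlonglongrightarrow> 0"
    using \<xi> by (intro tendsto_eventually) (auto elim: eventually_mono)
  ultimately have "clifford_C (\<mu> + 1) (inverse (x j)) = 0"
    by (rule LIMSEQ_unique)
  then show False
    using clifford_C_no_common_zero[OF order _ inverse_x_is_zero[OF assms(2)]] assms(2) by simp
qed

text \<open>
  Both series have terms bounded by a multiple of \<open>1 / (k + 1)\<^sup>2\<close>, uniformly in the row, which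
  justifies the passage to the limit. For the first one \<open>Y / (1 - t Y)\<close> is split into
  \<open>Y\<close>, whose sum is known, and \<open>t Y\<^sup>2 / (1 - t Y)\<close>.
\<close>

lemma sums_of_limit_points:
  assumes "clifford_C \<mu> t \<noteq> 0"
  shows "(\<lambda>k. t * ((x k)\<^sup>2 / (1 - t * x k))) sums (clifford_C (\<mu> + 1) t / clifford_C \<mu> t - 1 / (\<mu> + 1))"
    and "(\<lambda>k. (x k)\<^sup>2 / (1 - t * x k)\<^sup>2) sums
      ((clifford_C (\<mu> + 1) t / clifford_C \<mu> t)\<^sup>2 - clifford_C (\<mu> + 2) t / clifford_C \<mu> t)"
proof -
  define \<sigma> where "\<sigma> = 1 / (\<mu> + 1)"
  have nz: "1 - t * x k \<noteq> 0" for k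
    using assms clifford_C_zero_iff[of t] by auto
  then obtain \<delta> where \<delta>: "\<delta> > 0" "\<forall>\<^sub>F n in sequentially. \<forall>k. \<delta> \<le> \<bar>1 - t * Y n k\<bar>"
    using eventually_separated[of t] by (metis diff_self)
  have sq: "summable (\<lambda>k. (\<sigma> / (real k + 1))\<^sup>2)"
    using summable_mult[OF inverse_power_summable[of 2, where ?'a = real, THEN summable_Suc_iff[THEN iffD2]], of "\<sigma>\<^sup>2"]
    by (simp add: power_divide field_simps add_ac)
  have M: "summable (\<lambda>k. (\<sigma> / (real k + 1))\<^sup>2 / \<delta> ^ p)" for p
    by (rule summable_divide[OF sq])
  have bound: "\<forall>\<^sub>F (k, n) in sequentially \<times>\<^sub>F sequentially.
      norm ((Y n k)\<^sup>2 / (1 - t * Y n k) ^ p) \<le> (\<sigma> / (real k + 1))\<^sup>2 / \<delta> ^ p" for p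
  proof -
    have "\<forall>\<^sub>F (k :: nat, n) in sequentially \<times>\<^sub>F sequentially. \<forall>k. \<delta> \<le> \<bar>1 - t * Y n k\<bar>"
      using \<delta>(2) by (subst eventually_prod2) auto
    then show ?thesis
    proof (rule eventually_mono, clarify)
      fix k n assume *: "\<forall>k. \<delta> \<le> \<bar>1 - t * Y n k\<bar>"
      have "(Y n k)\<^sup>2 / \<bar>1 - t * Y n k\<bar> ^ p \<le> (\<sigma> / (real k + 1))\<^sup>2 / \<delta> ^ p"
        using * \<delta>(1) Y_le[of n k] Y_nonneg[of n k]
        by (intro frac_le power_mono) (auto simp: \<sigma>_def)
      then show "norm ((Y n k)\<^sup>2 / (1 - t * Y n k) ^ p) \<le> (\<sigma> / (real k + 1))\<^sup>2 / \<delta> ^ p"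
        by (simp add: abs_divide power_abs)
    qed
  qed
  have lim: "(\<lambda>n. (Y n k)\<^sup>2 / (1 - t * Y n k) ^ p) \<longlonglongrightarrow> (x k)\<^sup>2 / (1 - t * x k) ^ p" for k p
    using nz by (intro tendsto_intros Y_tendsto) auto
  note tannery = tannerys_theorem[OF lim bound M sequentially_bot]
  have summ: "summable (\<lambda>k. (x k)\<^sup>2 / (1 - t * x k) ^ p)" for p
    using tannery[of p] by (blast intro: summable_norm_cancel)
  have fin: "(\<Sum>k. (Y n k)\<^sup>2 / (1 - t * Y n k) ^ p) = (\<Sum>k\<le>\<phi> n. (Y n k)\<^sup>2 / (1 - t * Y n k) ^ p)" for n p
    using Y_beyond[of n] by (intro suminf_finite) (auto simp: not_le)
  have tend: "(\<lambda>n. \<Sum>k\<le>\<phi> n. (Y n k)\<^sup>2 / (1 - t * Y n k) ^ p) \<longlonglongrightarrow> (\<Sum>k. (x k)\<^sup>2 / (1 - t * x k) ^ p)" for p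
    using tannery[of p] unfolding fin by blast
  note ap = approx_tendsto[OF tendsto_const[of t]]
  have ev: "\<forall>\<^sub>F n in sequentially. approx0 n t \<noteq> 0 \<and> (\<forall>k. 1 - t * Y n k \<noteq> 0)"
    using \<delta>(2)
  proof eventually_elim
    case (elim n)
    have "t * Y n k \<noteq> 1" for k
      using elim[rule_format, of k] \<delta>(1) by auto
    then show ?case
      by (simp add: approx0_eq_0_iff)
  qed
  have "(\<lambda>n. (approx1 n t / approx0 n t)\<^sup>2 - approx2 n t / approx0 n t) \<longlonglongrightarrow>
      (clifford_C (\<mu> + 1) t / clifford_C \<mu> t)\<^sup>2 - clifford_C (\<mu> + 2) t / clifford_C \<mu> t"
    by (intro tendsto_intros ap assms)
  moreover have "(\<lambda>n. (approx1 n t / approx0 n t)\<^sup>2 - approx2 n t / approx0 n t) \<longlonglongrightarrow>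
      (\<Sum>k. (x k)\<^sup>2 / (1 - t * x k)\<^sup>2)"
  proof (rule Lim_transform_eventually[OF tend[of 2]])
    show "\<forall>\<^sub>F n in sequentially. (\<Sum>k\<le>\<phi> n. (Y n k)\<^sup>2 / (1 - t * Y n k)\<^sup>2)
        = (approx1 n t / approx0 n t)\<^sup>2 - approx2 n t / approx0 n t"
      using ev by eventually_elim (simp add: approx_log_derivatives)
  qed
  ultimately have "(clifford_C (\<mu> + 1) t / clifford_C \<mu> t)\<^sup>2 - clifford_C (\<mu> + 2) t / clifford_C \<mu> t
      = (\<Sum>k. (x k)\<^sup>2 / (1 - t * x k)\<^sup>2)"
    by (rule LIMSEQ_unique)
  then show "(\<lambda>k. (x k)\<^sup>2 / (1 - t * x k)\<^sup>2) sums
      ((clifford_C (\<mu> + 1) t / clifford_C \<mu> t)\<^sup>2 - clifford_C (\<mu> + 2) t / clifford_C \<mu> t)"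
    using summable_sums[OF summ[of 2]] by simp
  have "(\<lambda>n. approx1 n t / approx0 n t - \<sigma>) \<longlonglongrightarrow> clifford_C (\<mu> + 1) t / clifford_C \<mu> t - \<sigma>"
    by (intro tendsto_intros ap assms)
  moreover have "(\<lambda>n. approx1 n t / approx0 n t - \<sigma>) \<longlonglongrightarrow> t * (\<Sum>k. (x k)\<^sup>2 / (1 - t * x k))"
  proof (rule Lim_transform_eventually)
    show "(\<lambda>n. t * (\<Sum>k\<le>\<phi> n. (Y n k)\<^sup>2 / (1 - t * Y n k))) \<longlonglongrightarrow> t * (\<Sum>k. (x k)\<^sup>2 / (1 - t * x k))"
      using tendsto_mult_left[OF tend[of 1], of t] by simp
    show "\<forall>\<^sub>F n in sequentially. t * (\<Sum>k\<le>\<phi> n. (Y n k)\<^sup>2 / (1 - t * Y n k)) = approx1 n t / approx0 n t - \<sigma>"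
      using ev
    proof eventually_elim
      case (elim n)
      have "Y n k / (1 - t * Y n k) = Y n k + t * ((Y n k)\<^sup>2 / (1 - t * Y n k))" for k
        using elim by (simp add: field_simps power2_eq_square)
      then have "approx1 n t / approx0 n t = \<sigma> + t * (\<Sum>k\<le>\<phi> n. (Y n k)\<^sup>2 / (1 - t * Y n k))"
        using elim by (simp add: approx_log_derivatives[symmetric] sum.distrib sum_Y \<sigma>_def sum_distrib_left)
      then show ?case by simp
    qed
  qed
  ultimately have "clifford_C (\<mu> + 1) t / clifford_C \<mu> t - \<sigma> = t * (\<Sum>k. (x k)\<^sup>2 / (1 - t * x k))"
    by (rule LIMSEQ_unique)
  then show "(\<lambda>k. t * ((x k)\<^sup>2 / (1 - t * x k))) sums (clifford_C (\<mu> + 1) t / clifford_C \<mu> t - 1 / (\<mu> + 1))"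
    using sums_mult[OF summable_sums[OF summ[of 1]], of t] by (simp add: \<sigma>_def)
qed

lemma summable_x: "summable x"
  by (rule summableI_nonneg_bounded[OF x_nonneg sum_x_le])

text \<open>
  Here \<open>r\<close> is the value of \<open>C\<^sub>\<mu>\<^sub>+\<^sub>1 / C\<^sub>\<mu>\<close> at \<open>- y\<close>, and \<open>1 / (\<mu> + 1) - suminf x\<close> is the mass that may
  have escaped to \<open>0\<close>. The second series is the Riccati equation of this quotient.
\<close>

lemma negative_axis:
  assumes "y > 0"
  obtains r where "r \<ge> 0"
    "(\<lambda>k. x k / (1 + y * x k)) sums (r - (1 / (\<mu> + 1) - suminf x))"
    "(\<lambda>k. y * ((x k)\<^sup>2 / (1 + y * x k)\<^sup>2)) sums (y * r\<^sup>2 + (\<mu> + 1) * r - 1)"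
proof
  define r where "r = clifford_C (\<mu> + 1) (- y) / clifford_C \<mu> (- y)"
  have pos: "clifford_C \<mu> (- y) > 0" "clifford_C (\<mu> + 1) (- y) > 0"
    using assms order by (auto intro!: clifford_C_pos)
  then show "r \<ge> 0"
    by (simp add: r_def)
  have nz: "1 + y * x k > 0" for k
    using x_nonneg[of k] assms by (simp add: add_pos_nonneg)
  have "(\<lambda>k. - y * ((x k)\<^sup>2 / (1 + y * x k))) sums (r - 1 / (\<mu> + 1))"
    using sums_of_limit_points(1)[of "- y"] pos by (simp add: r_def)
  from sums_add[OF summable_sums[OF summable_x] this]
  have "(\<lambda>k. x k + - y * ((x k)\<^sup>2 / (1 + y * x k))) sums (r - (1 / (\<mu> + 1) - suminf x))"
    by (simp add: algebra_simps)
  moreover have "x k + - y * ((x k)\<^sup>2 / (1 + y * x k)) = x k / (1 + y * x k)" for k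
    using nz[of k] by (simp add: field_simps power2_eq_square)
  ultimately show "(\<lambda>k. x k / (1 + y * x k)) sums (r - (1 / (\<mu> + 1) - suminf x))"
    by simp
  have "(\<lambda>k. (x k)\<^sup>2 / (1 + y * x k)\<^sup>2) sums (r\<^sup>2 - clifford_C (\<mu> + 2) (- y) / clifford_C \<mu> (- y))"
    using sums_of_limit_points(2)[of "- y"] pos by (simp add: r_def)
  from sums_mult[OF this, of y]
  have "(\<lambda>k. y * ((x k)\<^sup>2 / (1 + y * x k)\<^sup>2)) sums (y * r\<^sup>2 - y * clifford_C (\<mu> + 2) (- y) / clifford_C \<mu> (- y))"
    by (simp add: algebra_simps)
  moreover have "y * clifford_C (\<mu> + 2) (- y) = clifford_C \<mu> (- y) - (\<mu> + 1) * clifford_C (\<mu> + 1) (- y)"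
    using clifford_C_recurrence[OF order, of "- y"] by simp
  then have "y * clifford_C (\<mu> + 2) (- y) / clifford_C \<mu> (- y) = 1 - (\<mu> + 1) * r"
    using pos by (simp add: r_def diff_divide_distrib)
  moreover have "y * r\<^sup>2 - (1 - (\<mu> + 1) * r) = y * r\<^sup>2 + (\<mu> + 1) * r - 1"
    by simp
  ultimately show "(\<lambda>k. y * ((x k)\<^sup>2 / (1 + y * x k)\<^sup>2)) sums (y * r\<^sup>2 + (\<mu> + 1) * r - 1)"
    by (simp only:)
qed

text \<open>
  No mass escapes. With \<open>a\<close> the missing mass, the first series on the negative axis gives
  \<open>r \<ge> a\<close>, and the second one is at most the sum of the \<open>x k\<close>, so that \<open>y a\<^sup>2\<close> stays bounded
  as \<open>y\<close> grows.
\<close>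

lemma sums_x: "x sums (1 / (\<mu> + 1))"
proof -
  define a where "a = 1 / (\<mu> + 1) - suminf x"
  have "a \<ge> 0"
    unfolding a_def using suminf_le_const[OF summable_x sum_x_le] by simp
  have bound: "y * a\<^sup>2 \<le> 1 + suminf x" if y: "y > 0" for y
  proof -
    obtain r where r: "r \<ge> 0" "(\<lambda>k. x k / (1 + y * x k)) sums (r - a)"
      "(\<lambda>k. y * ((x k)\<^sup>2 / (1 + y * x k)\<^sup>2)) sums (y * r\<^sup>2 + (\<mu> + 1) * r - 1)"
      unfolding a_def by (rule negative_axis[OF y])
    have yx: "y * x k \<ge> 0" for k
      using y x_nonneg[of k] by simp
    have "0 \<le> r - a"
      using r(2) by (rule sums_le[OF _ sums_zero, rotated]) (use x_nonneg yx in \<open>simp add: add_nonneg_nonneg\<close>)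
    have "y * ((x k)\<^sup>2 / (1 + y * x k)\<^sup>2) \<le> x k" for k
    proof -
      have "y * (x k)\<^sup>2 = x k * (y * x k)"
        by (simp add: power2_eq_square)
      also have "\<dots> \<le> x k * (1 + y * x k)\<^sup>2"
      proof (intro mult_left_mono x_nonneg)
        have "(1 + y * x k)\<^sup>2 = 1 + 2 * (y * x k) + (y * x k)\<^sup>2"
          by (simp add: power2_sum)
        then show "y * x k \<le> (1 + y * x k)\<^sup>2"
          using yx[of k] zero_le_power2[of "y * x k"] by linarith
      qed
      finally show ?thesis
        using yx[of k] by (simp add: pos_divide_le_eq add_pos_nonneg)
    qed
    then have "y * r\<^sup>2 + (\<mu> + 1) * r - 1 \<le> suminf x"
      using r(3) summable_sums[OF summable_x] by (rule sums_le)
    moreover have "(\<mu> + 1) * r \<ge> 0"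
      using r(1) order by simp
    moreover have "y * a\<^sup>2 \<le> y * r\<^sup>2"
      using \<open>0 \<le> r - a\<close> \<open>a \<ge> 0\<close> y by (intro mult_left_mono power_mono) auto
    ultimately show ?thesis by linarith
  qed
  have "suminf x \<ge> 0"
    by (rule suminf_nonneg[OF summable_x x_nonneg])
  have "\<not> a > 0"
  proof
    assume "a > 0"
    have "(2 + suminf x) / a\<^sup>2 * a\<^sup>2 \<le> 1 + suminf x"
      using \<open>a > 0\<close> \<open>suminf x \<ge> 0\<close> by (intro bound divide_pos_pos) auto
    with \<open>a > 0\<close> show False by simp
  qed
  with \<open>a \<ge> 0\<close> have "suminf x = 1 / (\<mu> + 1)"
    by (simp add: a_def)
  then show ?thesis
    using summable_sums[OF summable_x] by simp
qed

text \<open>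
  With only \<open>N\<close> zeros, \<open>r \<le> N / y\<close>. Then \<open>y r\<^sup>2 + (\<mu> + 1) r\<close> tends to \<open>0\<close>, while the second
  series on the negative axis has a nonnegative sum, so this quantity is at least \<open>1\<close>.
\<close>

lemma infinite_x_pos: "infinite {k. x k > 0}"
proof
  assume fin: "finite {k. x k > 0}"
  define N where "N = real (card {k. x k > 0})"
  (* Large enough for (N^2 + (\<mu> + 1) N) / y < 1. *)
  define y where "y = N\<^sup>2 + (\<mu> + 1) * N + 1"
  have "(\<mu> + 1) * N \<ge> 0"
    using order by (simp add: N_def)
  then have y: "y > 0"
    unfolding y_def using zero_le_power2[of N] by linarith
  obtain r where r: "r \<ge> 0" "(\<lambda>k. x k / (1 + y * x k)) sums r"
    "(\<lambda>k. y * ((x k)\<^sup>2 / (1 + y * x k)\<^sup>2)) sums (y * r\<^sup>2 + (\<mu> + 1) * r - 1)"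
    by (rule negative_axis[OF y, folded sums_unique[OF sums_x], unfolded diff_self diff_zero])
  have yx: "y * x k \<ge> 0" for k
    using y x_nonneg[of k] by simp
  have "r = (\<Sum>k\<in>{k. x k > 0}. x k / (1 + y * x k))"
  proof (rule sums_unique2[OF r(2)], rule sums_finite[OF fin])
    fix k assume "k \<notin> {k. x k > 0}"
    then show "x k / (1 + y * x k) = 0"
      using x_nonneg[of k] by simp
  qed
  also have "\<dots> \<le> (\<Sum>k\<in>{k. x k > 0}. 1 / y)"
    using y yx by (intro sum_mono) (simp add: field_simps add_pos_nonneg)
  finally have "r \<le> N / y"
    by (simp add: N_def)
  have "0 \<le> y * r\<^sup>2 + (\<mu> + 1) * r - 1"
    using r(3) by (rule sums_le[OF _ sums_zero, rotated]) (use y in simp)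
  moreover have "y * r\<^sup>2 \<le> y * (N / y)\<^sup>2"
    using \<open>r \<le> N / y\<close> r(1) y by (intro mult_left_mono power_mono) auto
  moreover have "(\<mu> + 1) * r \<le> (\<mu> + 1) * (N / y)"
    using \<open>r \<le> N / y\<close> order by (intro mult_left_mono) auto
  ultimately have "1 \<le> y * (N / y)\<^sup>2 + (\<mu> + 1) * (N / y)"
    by linarith
  also have "\<dots> = (N\<^sup>2 + (\<mu> + 1) * N) / y"
    using y by (simp add: field_simps power2_eq_square)
  finally show False
    using y by (simp add: y_def pos_le_divide_eq)
qed

text \<open>
  Term by term, \<open>x / (1 - t x)\<^sup>2 = x + t x\<^sup>2 / (1 - t x) + t x\<^sup>2 / (1 - t x)\<^sup>2\<close>, and all three
  series are known. The recurrence eliminates \<open>C\<^sub>\<mu>\<^sub>+\<^sub>2\<close>.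
\<close>

lemma sums_weighted:
  assumes "clifford_C \<mu> t \<noteq> 0"
  defines "r \<equiv> clifford_C (\<mu> + 1) t / clifford_C \<mu> t"
  shows "(\<lambda>k. x k / (1 - t * x k)\<^sup>2) sums (1 - \<mu> * r + t * r\<^sup>2)"
proof -
  note A = sums_of_limit_points[OF assms(1)]
  have nz: "1 - t * x k \<noteq> 0" for k
    using assms(1) clifford_C_zero_iff[of t] by auto
  have "(\<lambda>k. x k + t * ((x k)\<^sup>2 / (1 - t * x k)) + t * ((x k)\<^sup>2 / (1 - t * x k)\<^sup>2)) sums
      (1 / (\<mu> + 1) + (r - 1 / (\<mu> + 1)) + t * (r\<^sup>2 - clifford_C (\<mu> + 2) t / clifford_C \<mu> t))"
    unfolding r_def by (intro sums_add sums_mult sums_x A)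
  moreover have "x k + t * ((x k)\<^sup>2 / (1 - t * x k)) + t * ((x k)\<^sup>2 / (1 - t * x k)\<^sup>2)
      = x k / (1 - t * x k)\<^sup>2" for k
  proof -
    define d where "d = 1 - t * x k"
    have "x k + t * ((x k)\<^sup>2 / d) + t * ((x k)\<^sup>2 / d\<^sup>2) = x k * (d\<^sup>2 + t * x k * d + t * x k) / d\<^sup>2"
      using nz[of k] by (simp add: d_def[symmetric] field_simps power2_eq_square)
    also have "d\<^sup>2 + t * x k * d + t * x k = 1"
      by (simp add: d_def power2_eq_square algebra_simps)
    finally show ?thesis by (simp add: d_def)
  qed
  moreover have "t * clifford_C (\<mu> + 2) t = (\<mu> + 1) * clifford_C (\<mu> + 1) t - clifford_C \<mu> t"
    using clifford_C_recurrence[OF order, of t] by simp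
  then have "t * clifford_C (\<mu> + 2) t / clifford_C \<mu> t = (\<mu> + 1) * r - 1"
    using assms(1) by (simp add: r_def diff_divide_distrib)
  then have "1 / (\<mu> + 1) + (r - 1 / (\<mu> + 1)) + t * (r\<^sup>2 - clifford_C (\<mu> + 2) t / clifford_C \<mu> t)
      = 1 - \<mu> * r + t * r\<^sup>2"
    by (simp add: algebra_simps)
  ultimately show ?thesis by simp
qed

end

section \<open>Zeros of the Bessel function\<close>

lemma clifford_approximation_exists:
  assumes "\<mu> > -1"
  obtains \<phi> Y x where "clifford_convergent_approximation \<mu> \<phi> Y x"
proof -
  obtain X where X: "\<And>n k. k > n \<Longrightarrow> X n k = 0" "\<And>n k. k \<le> n \<Longrightarrow> 0 < X n k"
      "\<And>n i j. i < j \<Longrightarrow> j \<le> n \<Longrightarrow> X n j < X n i"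
      "\<And>n t. clifford (damping n) \<mu> t = clifford_term \<mu> 0 * (\<Prod>k\<le>n. 1 - t * X n k)"
    using clifford_damping_factorization[OF assms] by metis
  interpret full: clifford_approximation \<mu> id X
    by unfold_locales (use assms X in \<open>auto simp: strict_mono_def\<close>)
  have bound: "norm (X n k) \<le> 1 / (\<mu> + 1)" for n k
  proof -
    have "1 / (\<mu> + 1) / (real k + 1) \<le> 1 / (\<mu> + 1) / 1"
      using assms by (intro divide_left_mono) auto
    then show ?thesis
      using full.Y_le[of n k] full.Y_nonneg[of n k] by simp
  qed
  obtain \<phi> where \<phi>: "strict_mono (\<phi> :: nat \<Rightarrow> nat)"
      "\<And>k. k \<in> UNIV \<Longrightarrow> \<exists>l. (\<lambda>n. X (\<phi> n) k) \<longlonglongrightarrow> l"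
    by (rule function_convergent_subsequence[where f = X and S = UNIV, OF countableI_type bound]) (rule that)
  then obtain x where "\<And>k. (\<lambda>n. X (\<phi> n) k) \<longlonglongrightarrow> x k"
    by (metis UNIV_I)
  then have "clifford_convergent_approximation \<mu> \<phi> (\<lambda>n. X (\<phi> n)) x"
    by unfold_locales (use assms X \<phi> in auto)
  then show ?thesis by (rule that)
qed

lemma bessel_J_conv_clifford:
  assumes "\<mu> > -1" "x > 0"
  shows "bessel_J \<mu> x = (x / 2) powr \<mu> * clifford_C \<mu> (x\<^sup>2 / 4)"
proof -
  have "(-1) ^ m / (fact m * Gamma (real m + \<mu> + 1)) * (x / 2) powr (2 * real m + \<mu>)
      = (x / 2) powr \<mu> * (clifford_term \<mu> m * (- (x\<^sup>2 / 4)) ^ m)" for m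
  proof -
    have "(x / 2) powr (2 * real m + \<mu>) = (x / 2) powr \<mu> * (x / 2) ^ (2 * m)"
      using assms(2) by (simp add: powr_add powr_realpow[symmetric])
    also have "(x / 2) ^ (2 * m) = (x\<^sup>2 / 4) ^ m"
      by (simp add: power_mult power_divide)
    finally show ?thesis
      by (simp add: clifford_term_def power_minus[of "x\<^sup>2 / 4"])
  qed
  then show ?thesis
    unfolding bessel_J_def clifford_def
    using suminf_mult[OF summable_clifford_term[OF assms(1), of "- (x\<^sup>2 / 4)"], of "(x / 2) powr \<mu>"]
    by simp
qed

text \<open>
  Finiteness below every bound makes the least elements exist. It also makes the enumeration
  exhaustive: a point that is never reached would lie above infinitely many enumerated ones.
\<close>

lemma bij_betw_successive_least:
  fixes z :: "nat \<Rightarrow> real"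
  assumes z0: "z 0 = 0" and z_Suc: "\<And>n. z (Suc n) = (LEAST x. z n < x \<and> P x)"
    and S: "S = {x. 0 < x \<and> P x}" and inf: "infinite S" and fin: "\<And>B. finite (S \<inter> {..B})"
  shows "bij_betw z {1..} S"
proof -
  have step: "z n < z (Suc n) \<and> P (z (Suc n)) \<and> (\<forall>y. z n < y \<and> P y \<longrightarrow> z (Suc n) \<le> y)" if "z n \<ge> 0" for n
  proof -
    have "\<not> S \<subseteq> {..z n}"
      using inf fin[of "z n"] by (metis inf.absorb1)
    then obtain x0 where "x0 \<in> S" "\<not> x0 \<le> z n"
      by auto
    then have x0: "z n < x0" "P x0"
      by (auto simp: S)
    let ?T = "{x. z n < x \<and> P x}"
    have sub: "?T \<inter> {..x0} \<subseteq> S \<inter> {..x0}"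
      using that by (auto simp: S)
    have finT: "finite (?T \<inter> {..x0})"
      by (rule finite_subset[OF sub fin])
    define m where "m = Min (?T \<inter> {..x0})"
    have "m \<in> ?T \<inter> {..x0}"
      unfolding m_def using finT x0 by (intro Min_in) auto
    then have m: "z n < m" "P m" "m \<le> x0"
      by auto
    have least: "m \<le> y" if "z n < y \<and> P y" for y
    proof (cases "y \<le> x0")
      case True
      then show ?thesis
        unfolding m_def using finT that by (intro Min_le) auto
    qed (use m in auto)
    have "z (Suc n) = m"
      unfolding z_Suc using m least by (intro Least_equality) auto
    with m least show ?thesis by blast
  qed
  have nonneg: "z n \<ge> 0" for n
  proof (induction n)
    case (Suc n)
    then show ?case using step[of n] by linarith
  qed (simp add: z0)
  have mono: "strict_mono z"
    using step[OF nonneg] by (intro strict_mono_Suc_iff[THEN iffD2]) blast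
  have in_S: "z n \<in> S" if "n \<ge> 1" for n
  proof -
    from that obtain j where "n = Suc j" by (cases n) auto
    then show ?thesis
      using step[OF nonneg[of j]] nonneg[of j] by (auto simp: S)
  qed
  show ?thesis
  proof (rule bij_betw_imageI)
    show "inj_on z {1..}"
      using strict_mono_imp_inj_on[OF mono] by (rule inj_on_subset) auto
    show "z ` {1..} = S"
    proof
      show "z ` {1..} \<subseteq> S" using in_S by auto
      show "S \<subseteq> z ` {1..}"
      proof (rule ccontr)
        assume "\<not> S \<subseteq> z ` {1..}"
        then obtain s where s: "s \<in> S" "s \<notin> z ` {1..}" by blast
        have below: "z n < s" for n
        proof (induction n)
          case 0
          then show ?case using s by (simp add: z0 S)
        next
          case (Suc n)
          then have "z (Suc n) \<le> s"
            using step[OF nonneg[of n]] s(1) by (auto simp: S)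
          moreover have "z (Suc n) \<noteq> s"
            using s(2) by auto
          ultimately show ?case by simp
        qed
        have "z ` {1..} \<subseteq> S \<inter> {..s}"
          using in_S below less_imp_le by blast
        then have "finite (z ` {1..})"
          using fin finite_subset by blast
        then show False
          using finite_imageD[OF _ \<open>inj_on z {1..}\<close>] infinite_Ici by blast
      qed
    qed
  qed
qed

context clifford_convergent_approximation
begin

abbreviation zero_of :: "nat \<Rightarrow> real" where
  "zero_of k \<equiv> 2 / sqrt (x k)"

lemma zero_of_pos: "x k > 0 \<Longrightarrow> zero_of k > 0"
  by simp

lemma zero_of_power2: "x k > 0 \<Longrightarrow> (zero_of k)\<^sup>2 = 4 / x k"
  by (simp add: power_divide)

lemma bij_betw_zero_of: "bij_betw zero_of {k. x k > 0} {s. 0 < s \<and> bessel_J \<mu> s = 0}"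
proof (rule bij_betw_imageI)
  show "inj_on zero_of {k. x k > 0}"
  proof (rule inj_onI)
    fix i j assume *: "i \<in> {k. x k > 0}" "j \<in> {k. x k > 0}" "zero_of i = zero_of j"
    then have "x i = x j" by simp
    with * x_distinct show "i = j"
      by (metis linorder_neqE_nat mem_Collect_eq)
  qed
  have zero_iff: "bessel_J \<mu> s = 0 \<longleftrightarrow> (\<exists>k. s\<^sup>2 / 4 * x k = 1)" if "s > 0" for s
    using bessel_J_conv_clifford[OF order that] that by (simp add: clifford_C_zero_iff)
  show "zero_of ` {k. x k > 0} = {s. 0 < s \<and> bessel_J \<mu> s = 0}"
  proof safe
    fix k assume k: "x k > 0"
    then show "0 < zero_of k" by simp
    have "(zero_of k)\<^sup>2 / 4 * x k = 1"
      unfolding zero_of_power2[OF k] using k by simp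
    then show "bessel_J \<mu> (zero_of k) = 0"
      using zero_iff[OF zero_of_pos[OF k]] by blast
  next
    fix s :: real assume s: "0 < s" "bessel_J \<mu> s = 0"
    then obtain k where k: "s\<^sup>2 / 4 * x k = 1"
      using zero_iff by blast
    then have "x k \<noteq> 0" by auto
    then have pos: "x k > 0" using x_nonneg[of k] by simp
    have "(zero_of k)\<^sup>2 = s\<^sup>2"
      unfolding zero_of_power2[OF pos] using k pos by (simp add: field_simps)
    then have "s = zero_of k"
      using zero_of_pos[OF pos] s(1) by (simp only: power2_eq_iff_nonneg less_imp_le)
    with pos show "s \<in> zero_of ` {k. x k > 0}" by blast
  qed
qed

lemma bij_betw_bessel_zero: "bij_betw (bessel_zero \<mu>) {1..} {s. 0 < s \<and> bessel_J \<mu> s = 0}"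
proof (rule bij_betw_successive_least[OF _ _ refl])
  show "infinite {s. 0 < s \<and> bessel_J \<mu> s = 0}"
    using infinite_x_pos bij_betw_finite[OF bij_betw_zero_of] by blast
  fix B
  obtain N :: nat where N: "B\<^sup>2 * (1 / (\<mu> + 1)) \<le> real N"
    using real_arch_simple by blast
  have "{s. 0 < s \<and> bessel_J \<mu> s = 0} \<inter> {..B} \<subseteq> zero_of ` {..N}"
  proof
    fix s assume s: "s \<in> {s. 0 < s \<and> bessel_J \<mu> s = 0} \<inter> {..B}"
    then obtain k where k: "x k > 0" "s = zero_of k"
      using bij_betw_imp_surj_on[OF bij_betw_zero_of] by blast
    have "s\<^sup>2 \<le> B\<^sup>2"
      using s by (intro power_mono) auto
    then have "4 \<le> B\<^sup>2 * x k"
      using k(1) unfolding k(2) zero_of_power2[OF k(1)] by (simp add: field_simps)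
    also have "\<dots> \<le> B\<^sup>2 * (1 / (\<mu> + 1) / (real k + 1))"
      by (intro mult_left_mono x_le) auto
    finally have "4 \<le> B\<^sup>2 * (1 / (\<mu> + 1)) / (real k + 1)"
      by (simp only: times_divide_eq_right)
    then have "4 * (real k + 1) \<le> B\<^sup>2 * (1 / (\<mu> + 1))"
      by (rule iffD1[OF pos_le_divide_eq, rotated]) simp
    from order_trans[OF this N] have "k \<le> N" by simp
    with k show "s \<in> zero_of ` {..N}" by blast
  qed
  then show "finite ({s. 0 < s \<and> bessel_J \<mu> s = 0} \<inter> {..B})"
    by (rule finite_subset) simp
qed simp_all

lemma has_sum_bessel_zeros:
  assumes "clifford_C \<mu> (w\<^sup>2 / 4) \<noteq> 0"
  defines "r \<equiv> clifford_C (\<mu> + 1) (w\<^sup>2 / 4) / clifford_C \<mu> (w\<^sup>2 / 4)"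
  shows "((\<lambda>k. (bessel_zero \<mu> k)\<^sup>2 / (w\<^sup>2 - (bessel_zero \<mu> k)\<^sup>2)\<^sup>2) has_sum
    (1 - \<mu> * r + w\<^sup>2 / 4 * r\<^sup>2) / 4) {1..}"
proof -
  define t where "t = w\<^sup>2 / 4"
  define f where "f s = s\<^sup>2 / (w\<^sup>2 - s\<^sup>2)\<^sup>2" for s :: real
  have "((\<lambda>k. x k / (1 - t * x k)\<^sup>2) has_sum (1 - \<mu> * r + w\<^sup>2 / 4 * r\<^sup>2)) UNIV"
    using sums_nonneg_imp_has_sum[OF sums_weighted[OF assms(1)]] x_nonneg by (simp add: r_def t_def)
  then have "((\<lambda>k. x k / (1 - t * x k)\<^sup>2) has_sum (1 - \<mu> * r + w\<^sup>2 / 4 * r\<^sup>2)) {k. x k > 0}"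
    by (subst has_sum_cong_neutral[where T = UNIV and g = "\<lambda>k. x k / (1 - t * x k)\<^sup>2"])
       (use x_nonneg in \<open>auto simp: not_less intro!: antisym\<close>)
  from has_sum_cmult_right[OF this, of "1 / 4"]
  have *: "((\<lambda>k. 1 / 4 * (x k / (1 - t * x k)\<^sup>2)) has_sum (1 - \<mu> * r + w\<^sup>2 / 4 * r\<^sup>2) / 4) {k. x k > 0}"
    by simp
  have "1 / 4 * (x k / (1 - t * x k)\<^sup>2) = f (zero_of k)" if k: "x k > 0" for k
  proof -
    define d where "d = 1 - t * x k"
    have "w\<^sup>2 - (zero_of k)\<^sup>2 = - 4 * d / x k"
      unfolding zero_of_power2[OF k] t_def d_def using k by (simp add: field_simps)
    then have "f (zero_of k) = (4 / x k) / (- 4 * d / x k)\<^sup>2"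
      unfolding f_def zero_of_power2[OF k] by (simp only:)
    also have "\<dots> = 1 / 4 * (x k / d\<^sup>2)"
      using k by (simp add: power_divide power_mult_distrib) (simp add: power2_eq_square)
    finally show ?thesis
      by (simp add: d_def)
  qed
  with * have "((\<lambda>k. f (zero_of k)) has_sum (1 - \<mu> * r + w\<^sup>2 / 4 * r\<^sup>2) / 4) {k. x k > 0}"
    by (subst has_sum_cong[where g = "\<lambda>k. 1 / 4 * (x k / (1 - t * x k)\<^sup>2)"]) auto
  then have "(f has_sum (1 - \<mu> * r + w\<^sup>2 / 4 * r\<^sup>2) / 4) {s. 0 < s \<and> bessel_J \<mu> s = 0}"
    by (subst (asm) has_sum_reindex_bij_betw[OF bij_betw_zero_of])
  then have "((\<lambda>k. f (bessel_zero \<mu> k)) has_sum (1 - \<mu> * r + w\<^sup>2 / 4 * r\<^sup>2) / 4) {1..}"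
    by (subst has_sum_reindex_bij_betw[OF bij_betw_bessel_zero])
  then show ?thesis
    by (simp add: f_def)
qed

end

lemma bessel_zero_is_zero:
  assumes "\<mu> > -1" "n \<ge> 1"
  shows "bessel_zero \<mu> n > 0" "bessel_J \<mu> (bessel_zero \<mu> n) = 0"
proof -
  obtain \<phi> Y x where "clifford_convergent_approximation \<mu> \<phi> Y x"
    using clifford_approximation_exists[OF assms(1)] .
  from bij_betwE[OF clifford_convergent_approximation.bij_betw_bessel_zero[OF this]] assms(2)
  show "bessel_zero \<mu> n > 0" "bessel_J \<mu> (bessel_zero \<mu> n) = 0"
    by auto
qed

theorem mainTheorem4:
  fixes \<nu> :: real and n :: nat
  assumes "\<nu> > -1" and "n \<ge> 1"
  shows "((\<lambda>k. (bessel_zero (\<nu> + 1) k)\<^sup>2 /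
              ((bessel_zero \<nu> n)\<^sup>2 - (bessel_zero (\<nu> + 1) k)\<^sup>2)\<^sup>2)
          has_sum (1 / 4)) {1..}"
proof -
  define w where "w = bessel_zero \<nu> n"
  define t where "t = w\<^sup>2 / 4"
  have w: "w > 0" "bessel_J \<nu> w = 0"
    unfolding w_def using bessel_zero_is_zero[OF assms] by auto
  have t: "t > 0" "clifford_C \<nu> t = 0"
    using w bessel_J_conv_clifford[OF assms(1) w(1)] by (auto simp: t_def)
  have nz: "clifford_C (\<nu> + 1) t \<noteq> 0"
    by (rule clifford_C_no_common_zero[OF assms(1) t])
  define r where "r = clifford_C (\<nu> + 1 + 1) t / clifford_C (\<nu> + 1) t"
  have "t * clifford_C (\<nu> + 1 + 1) t = (\<nu> + 1) * clifford_C (\<nu> + 1) t"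
    using clifford_C_recurrence[OF assms(1), of t] t(2) by (simp add: add.assoc)
  then have "t * r = \<nu> + 1"
    using nz by (simp add: r_def field_simps)
  then have "1 - (\<nu> + 1) * r + t * r\<^sup>2 = 1"
    by (simp add: power2_eq_square flip: mult.assoc)
  moreover have "\<nu> + 1 > -1"
    using assms(1) by simp
  then obtain \<phi> Y x where "clifford_convergent_approximation (\<nu> + 1) \<phi> Y x"
    using clifford_approximation_exists by blast
  from clifford_convergent_approximation.has_sum_bessel_zeros[OF this, of w] nz
  have "((\<lambda>k. (bessel_zero (\<nu> + 1) k)\<^sup>2 / (w\<^sup>2 - (bessel_zero (\<nu> + 1) k)\<^sup>2)\<^sup>2) has_sum
    (1 - (\<nu> + 1) * r + t * r\<^sup>2) / 4) {1..}"
    by (simp add: t_def r_def)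
  ultimately show ?thesis
    by (simp add: w_def)
qed

end
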